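(* Let $(W,S)$ be a Coxeter system whose nerve $L$ is a graph with no $3$-cycles, all of whose edges carry the same label $m$ (i.e. $m_{st}=m$ whenever $\{s,t\}$ is an edge of $L$). If $m$ is a multiple of $\operatorname{lcm}_{s\in S}\deg(s)$, where $\deg(s)$ is the degree of the vertex $s$ in $L$, then $L^2_\mathbf{q}H_2(\Sigma(W,S))=0$ for every multiparameter $\mathbf{q}\le\mathbf{1}$.
   Context: The nerve $L$ of $(W,S)$ is the simplicial complex with vertex set $S$ whose simplices are the nonempty spherical subsets (those generating finite subgroups); here it is one-dimensional, edges $\{s,t\}$ labeled by $m_{st}$, and non-adjacent $s,t$ have $m_{st}=\infty$. A multiparameter is $\mathbf{q}=(q_s)_{s\in S}$, $q_s>0$, constant on conjugacy classes; $\mathbf{q}\le\mathbf{1}$ means $q_s\le1$ for all $s$. Weighted $L^2$-homology of the Davis complex $\Sigma(W,S)$: cell $w\sigma$ gets measure $q_u$, $u$ the shortest element of $wW_{S(\sigma)}$; chains square-summable for $\sum f(\sigma)g(\sigma)\mu_\mathbf{q}(\sigma)$; boundary $\partial^\mathbf{q}$ the adjoint of the coboundary; $L^2_\mathbf{q}H_i=\ker\partial^\mathbf{q}_i/\overline{\operatorname{im}\partial^\mathbf{q}_{i+1}}$. *)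

theory Defs
  imports Complex_Main "HOL-Library.Extended_Nat" "HOL-Analysis.Infinite_Sum"
begin

text \<open>A Coxeter matrix on a (finite) generating set S; entries in enat, with
  infinity meaning "no relation".\<close>
definition coxeter_matrix :: "'s set \<Rightarrow> ('s \<Rightarrow> 's \<Rightarrow> enat) \<Rightarrow> bool" where
  "coxeter_matrix S M \<longleftrightarrow>
     (\<forall>s\<in>S. M s s = 1) \<and> (\<forall>s\<in>S. \<forall>t\<in>S. M s t = M t s) \<and>
     (\<forall>s\<in>S. \<forall>t\<in>S. s \<noteq> t \<longrightarrow> M s t \<ge> 2)"

text \<open>The congruence on words over S generated by the Coxeter relations
  (st)^(m_st) = 1 (for s = t this is s^2 = 1).  W = words / cox_eq.\<close>
inductive cox_eq :: "'s set \<Rightarrow> ('s \<Rightarrow> 's \<Rightarrow> enat) \<Rightarrow> 's list \<Rightarrow> 's list \<Rightarrow> bool"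
  for S M where
  refl: "w \<in> lists S \<Longrightarrow> cox_eq S M w w"
| sym: "cox_eq S M v w \<Longrightarrow> cox_eq S M w v"
| trans: "cox_eq S M u v \<Longrightarrow> cox_eq S M v w \<Longrightarrow> cox_eq S M u w"
| rel: "xs \<in> lists S \<Longrightarrow> ys \<in> lists S \<Longrightarrow> s \<in> S \<Longrightarrow> t \<in> S \<Longrightarrow> M s t = enat k \<Longrightarrow>
        cox_eq S M (xs @ concat (replicate k [s, t]) @ ys) (xs @ ys)"

definition cox_class :: "'s set \<Rightarrow> ('s \<Rightarrow> 's \<Rightarrow> enat) \<Rightarrow> 's list \<Rightarrow> 's list set" where
  "cox_class S M w = {v \<in> lists S. cox_eq S M v w}"

definition cox_group :: "'s set \<Rightarrow> ('s \<Rightarrow> 's \<Rightarrow> enat) \<Rightarrow> 's list set set" where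
  "cox_group S M = cox_class S M ` lists S"

definition cox_mult :: "'s set \<Rightarrow> ('s \<Rightarrow> 's \<Rightarrow> enat) \<Rightarrow> 's list set \<Rightarrow> 's list set \<Rightarrow> 's list set" where
  "cox_mult S M X Y = cox_class S M ((SOME x. x \<in> X) @ (SOME y. y \<in> Y))"

definition special_subgroup :: "'s set \<Rightarrow> ('s \<Rightarrow> 's \<Rightarrow> enat) \<Rightarrow> 's set \<Rightarrow> 's list set set" where
  "special_subgroup S M T = cox_class S M ` lists T"

definition cox_coset :: "'s set \<Rightarrow> ('s \<Rightarrow> 's \<Rightarrow> enat) \<Rightarrow> 's set \<Rightarrow> 's list set \<Rightarrow> 's list set set" where
  "cox_coset S M T X = {cox_mult S M X Y | Y. Y \<in> special_subgroup S M T}"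

definition spherical :: "'s set \<Rightarrow> ('s \<Rightarrow> 's \<Rightarrow> enat) \<Rightarrow> 's set \<Rightarrow> bool" where
  "spherical S M T \<longleftrightarrow> T \<subseteq> S \<and> finite (special_subgroup S M T)"

definition nerve_edge :: "'s set \<Rightarrow> ('s \<Rightarrow> 's \<Rightarrow> enat) \<Rightarrow> 's \<Rightarrow> 's \<Rightarrow> bool" where
  "nerve_edge S M s t \<longleftrightarrow> s \<in> S \<and> t \<in> S \<and> s \<noteq> t \<and> spherical S M {s, t}"

definition nerve_degree :: "'s set \<Rightarrow> ('s \<Rightarrow> 's \<Rightarrow> enat) \<Rightarrow> 's \<Rightarrow> nat" where
  "nerve_degree S M s = card {t \<in> S. nerve_edge S M s t}"

definition cox_length :: "'s set \<Rightarrow> ('s \<Rightarrow> 's \<Rightarrow> enat) \<Rightarrow> 's list set \<Rightarrow> nat" where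
  "cox_length S M X = (LEAST n. \<exists>w\<in>X. length w = n)"

definition is_multiparameter :: "'s set \<Rightarrow> ('s \<Rightarrow> 's \<Rightarrow> enat) \<Rightarrow> ('s \<Rightarrow> real) \<Rightarrow> bool" where
  "is_multiparameter S M q \<longleftrightarrow>
     (\<forall>s\<in>S. q s > 0) \<and>
     (\<forall>s\<in>S. \<forall>t\<in>S. (\<exists>w\<in>lists S. cox_eq S M (w @ [s] @ rev w) [t]) \<longrightarrow> q s = q t)"

definition mparam_q :: "'s set \<Rightarrow> ('s \<Rightarrow> 's \<Rightarrow> enat) \<Rightarrow> ('s \<Rightarrow> real) \<Rightarrow> 's list set \<Rightarrow> real" where
  "mparam_q S M q X = prod_list (map q (SOME w. w \<in> X \<and> length w = cox_length S M X))"

definition shortest :: "'s set \<Rightarrow> ('s \<Rightarrow> 's \<Rightarrow> enat) \<Rightarrow> 's list set set \<Rightarrow> 's list set" where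
  "shortest S M C = (SOME u. u \<in> C \<and> (\<forall>v\<in>C. cox_length S M u \<le> cox_length S M v))"

text \<open>A cell w\<sigma> of the Davis complex is represented by the pair (T, w W_T), T spherical;
  its dimension is card T.\<close>
type_synonym 's cell = "'s set \<times> 's list set set"

definition davis_cells :: "'s set \<Rightarrow> ('s \<Rightarrow> 's \<Rightarrow> enat) \<Rightarrow> nat \<Rightarrow> 's cell set" where
  "davis_cells S M k =
     {(T, cox_coset S M T X) | T X. X \<in> cox_group S M \<and> spherical S M T \<and> card T = k}"

definition cell_measure :: "'s set \<Rightarrow> ('s \<Rightarrow> 's \<Rightarrow> enat) \<Rightarrow> ('s \<Rightarrow> real) \<Rightarrow> 's cell \<Rightarrow> real" where
  "cell_measure S M q c = mparam_q S M q (shortest S M (snd c))"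

text \<open>Orientations.  A 1-cell {x, xs} is oriented from its shortest element to the other.
  A 2-cell u W_{s,t} (u shortest, s0, t0 a chosen ordering of {s,t}, m = m_{s t}) is the
  2m-gon with vertices v_i = u \<cdot> (s0 t0 s0 \<dots>) (i letters), i = 0..2m, v_{2m} = v_0,
  its boundary being traversed v_0 \<rightarrow> v_1 \<rightarrow> \<dots> \<rightarrow> v_{2m}.\<close>
definition poly_vertex :: "'s set \<Rightarrow> ('s \<Rightarrow> 's \<Rightarrow> enat) \<Rightarrow> 's cell \<Rightarrow> nat \<Rightarrow> 's list set" where
  "poly_vertex S M \<tau> i =
     (let s0 = (SOME s. s \<in> fst \<tau>); t0 = (SOME t. t \<in> fst \<tau> \<and> t \<noteq> s0)
      in cox_mult S M (shortest S M (snd \<tau>))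
           (cox_class S M (take i (concat (replicate i [s0, t0])))))"

definition poly_size :: "'s set \<Rightarrow> ('s \<Rightarrow> 's \<Rightarrow> enat) \<Rightarrow> 's cell \<Rightarrow> nat" where
  "poly_size S M \<tau> =
     (let s0 = (SOME s. s \<in> fst \<tau>); t0 = (SOME t. t \<in> fst \<tau> \<and> t \<noteq> s0)
      in 2 * the_enat (M s0 t0))"

definition cell_inc :: "'s set \<Rightarrow> ('s \<Rightarrow> 's \<Rightarrow> enat) \<Rightarrow> 's cell \<Rightarrow> 's cell \<Rightarrow> int" where
  "cell_inc S M \<tau> e =
     (if fst e \<subseteq> fst \<tau> \<and> (\<exists>i < poly_size S M \<tau>.
            snd e = {poly_vertex S M \<tau> i, poly_vertex S M \<tau> (Suc i)} \<and>
            shortest S M (snd e) = poly_vertex S M \<tau> i) then 1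
      else if fst e \<subseteq> fst \<tau> \<and> (\<exists>i < poly_size S M \<tau>.
            snd e = {poly_vertex S M \<tau> i, poly_vertex S M \<tau> (Suc i)} \<and>
            shortest S M (snd e) = poly_vertex S M \<tau> (Suc i)) then -1
      else 0)"

definition l2q_chain :: "'s set \<Rightarrow> ('s \<Rightarrow> 's \<Rightarrow> enat) \<Rightarrow> ('s \<Rightarrow> real) \<Rightarrow> nat \<Rightarrow> ('s cell \<Rightarrow> real) \<Rightarrow> bool" where
  "l2q_chain S M q k g \<longleftrightarrow>
     (\<lambda>c. (g c)\<^sup>2 * cell_measure S M q c) summable_on davis_cells S M k"

text \<open>The weighted boundary \<partial>^q_2, i.e. the adjoint of the coboundary
  (\<delta> f)(\<tau>) = \<Sum>_e [\<tau>:e] f(e) with respect to the weighted inner products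
  \<Sum> f g \<mu>_q:  (\<partial>^q g)(e) = \<mu>_q(e)^{-1} \<Sum>_\<tau> [\<tau>:e] \<mu>_q(\<tau>) g(\<tau>).\<close>
definition wbdry2 :: "'s set \<Rightarrow> ('s \<Rightarrow> 's \<Rightarrow> enat) \<Rightarrow> ('s \<Rightarrow> real) \<Rightarrow> ('s cell \<Rightarrow> real) \<Rightarrow> 's cell \<Rightarrow> real" where
  "wbdry2 S M q g e =
     (\<Sum>\<tau>\<in>{\<tau> \<in> davis_cells S M 2. cell_inc S M \<tau> e \<noteq> 0}.
        of_int (cell_inc S M \<tau> e) * cell_measure S M q \<tau> * g \<tau>) / cell_measure S M q e"

text \<open>L^2_q H_2 = ker \<partial>^q_2 / closure(im \<partial>^q_3).  When the nerve is a graph, \<Sigma> has no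
  3-cells, so \<partial>^q_3 = 0 and vanishing of L^2_q H_2 means ker \<partial>^q_2 = 0.\<close>
definition L2q_H2_vanishes :: "'s set \<Rightarrow> ('s \<Rightarrow> 's \<Rightarrow> enat) \<Rightarrow> ('s \<Rightarrow> real) \<Rightarrow> bool" where
  "L2q_H2_vanishes S M q \<longleftrightarrow>
     (\<forall>g. l2q_chain S M q 2 g \<and> (\<forall>e \<in> davis_cells S M 1. wbdry2 S M q g e = 0)
          \<longrightarrow> (\<forall>\<tau> \<in> davis_cells S M 2. g \<tau> = 0))"

end

theory Submission
  imports Defs "HOL-Analysis.Convex"
begin

text \<open>
  If \<open>g\<close> is in the kernel of the weighted boundary, then \<open>h = \<mu> g\<close> is an ordinary cellular cycle,
  square summable because \<open>\<mu> \<le> 1\<close>. Call an edge of a 2-cell a top edge if it misses the shortest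
  vertex of the cell; a \<open>2m\<close>-gon has \<open>2m - 2\<close> of them. Since the nerve has no triangles, a top edge
  of \<open>\<tau>\<close> is one of the two bottom edges of each of the at most \<open>m - 1\<close> other cells containing it.
  The cycle condition and Cauchy--Schwarz give \<open>h(\<tau>)\<^sup>2 \<le> (m - 1) \<Sum> h(\<tau>')\<^sup>2\<close>
  over those cells. Summed over all top edges of all cells this reads \<open>2 \<Sum> h\<^sup>2 \<le> 2 \<Sum> h\<^sup>2\<close>, so
  equality holds throughout, and \<open>h\<close> vanishes by induction on the length of the shortest vertex.
\<close>

section \<open>Square-summable functions on a descending incidence structure\<close>

text \<open>The divisibility hypothesis supplies deg(s) <= m, because each degree divides the
  nonzero number m; an edge labeled by s lies in at most deg(s) cells. The factor m - 1 from
  Cauchy-Schwarz then cancels against the 2(m - 1) top edges and leaves 2, exactly the number of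
  bottom edges of a polygon. The count has no slack, so it yields equality rather than vanishing,
  and equality has to be propagated: a cell with no incidence below it satisfies 2 h^2 = 0, and once
  h vanishes on a cell, equality kills h on every cell sharing one of its top edges. The group is
  given as words modulo a congruence, so the geometry must be extracted from the presentation.
  Lengths and minimal coset representatives come from the parity with which a gallery crosses a
  wall, an invariant of the relations. That a polygon has 2m distinct vertices comes from an action
  on the integers modulo m in which st translates by 1.\<close>

lemma square_summable_descent_vanishes:
  fixes h :: "'f \<Rightarrow> real" and top :: "'f \<Rightarrow> 'e set" and cells :: "'e \<Rightarrow> 'f set"
    and F :: "'f set" and rank :: "'f \<Rightarrow> nat" and m :: nat
  defines "below \<equiv> \<lambda>\<tau>'. {(\<tau>, e). \<tau> \<in> F \<and> e \<in> top \<tau> \<and> \<tau>' \<in> cells e \<and> \<tau>' \<noteq> \<tau>}"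
  assumes m: "m \<ge> 2"
    and summable: "(\<lambda>\<tau>. (h \<tau>)\<^sup>2) summable_on F"
    and top: "\<And>\<tau>. \<tau> \<in> F \<Longrightarrow> finite (top \<tau>) \<and> card (top \<tau>) \<ge> 2 * (m - 1)"
    and cells: "\<And>\<tau> e. \<tau> \<in> F \<Longrightarrow> e \<in> top \<tau> \<Longrightarrow>
      finite (cells e) \<and> cells e \<subseteq> F \<and> \<tau> \<in> cells e \<and> card (cells e) \<le> m"
    and cycle: "\<And>\<tau> e. \<tau> \<in> F \<Longrightarrow> e \<in> top \<tau> \<Longrightarrow> \<bar>h \<tau>\<bar> \<le> (\<Sum>\<tau>'\<in>cells e - {\<tau>}. \<bar>h \<tau>'\<bar>)"
    and below: "\<And>\<tau>'. \<tau>' \<in> F \<Longrightarrow> finite (below \<tau>') \<and> card (below \<tau>') \<le> 2"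
    and rank: "\<And>\<tau> e \<tau>'. \<tau>' \<in> F \<Longrightarrow> (\<tau>, e) \<in> below \<tau>' \<Longrightarrow> rank \<tau> < rank \<tau>'"
    and "\<tau> \<in> F"
  shows "h \<tau> = 0"
proof -
  define f where "f \<tau> = (h \<tau>)\<^sup>2" for \<tau>
  define G where "G \<tau> = (\<Sum>e\<in>top \<tau>. \<Sum>\<tau>'\<in>cells e - {\<tau>}. f \<tau>')" for \<tau>
  define b where "b \<tau> = real (card (below \<tau>))" for \<tau>
  have f0: "f \<tau> \<ge> 0" for \<tau> by (simp add: f_def)
  have fs: "f summable_on F" unfolding f_def by (rule summable)
  have b2: "0 \<le> b \<tau>" "b \<tau> \<le> 2" if "\<tau> \<in> F" for \<tau> using below[OF that] by (auto simp: b_def)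
  have G0: "G \<tau> \<ge> 0" for \<tau> by (simp add: G_def sum_nonneg f0)
  have lower: "2 * f \<tau> \<le> G \<tau>" if "\<tau> \<in> F" for \<tau>
  proof -
    have "f \<tau> \<le> real (m - 1) * (\<Sum>\<tau>'\<in>cells e - {\<tau>}. f \<tau>')" if e: "e \<in> top \<tau>" for e
    proof -
      note c = cells[OF \<open>\<tau> \<in> F\<close> e]
      have "f \<tau> = \<bar>h \<tau>\<bar>\<^sup>2" by (simp add: f_def)
      also have "\<dots> \<le> (\<Sum>\<tau>'\<in>cells e - {\<tau>}. \<bar>h \<tau>'\<bar>)\<^sup>2"
        by (intro power_mono cycle \<open>\<tau> \<in> F\<close> e) simp
      also have "\<dots> \<le> real (card (cells e - {\<tau>})) * (\<Sum>\<tau>'\<in>cells e - {\<tau>}. f \<tau>')"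
        using Cauchy_Schwarz_ineq_sum[of "\<lambda>_. 1" "\<lambda>\<tau>. \<bar>h \<tau>\<bar>" "cells e - {\<tau>}"]
        by (simp add: f_def)
      also have "\<dots> \<le> real (m - 1) * (\<Sum>\<tau>'\<in>cells e - {\<tau>}. f \<tau>')"
        using c by (intro mult_right_mono) (auto simp: sum_nonneg f0)
      finally show ?thesis .
    qed
    then have "real (card (top \<tau>)) * f \<tau> \<le> real (m - 1) * G \<tau>"
      unfolding G_def sum_distrib_left using sum_bounded_below[of "top \<tau>" "f \<tau>"] by (simp add: mult.commute)
    moreover have "real (2 * (m - 1)) * f \<tau> \<le> real (card (top \<tau>)) * f \<tau>"
      using top[OF that] by (intro mult_right_mono f0) linarith
    ultimately have "real (m - 1) * (2 * f \<tau>) \<le> real (m - 1) * G \<tau>" by (simp add: mult.assoc)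
    moreover have "real (m - 1) > 0" using m by simp
    ultimately show ?thesis by (metis mult_le_cancel_left_pos)
  qed
  have bfs: "(\<lambda>\<tau>. b \<tau> * f \<tau>) summable_on F"
    by (rule summable_on_comparison_test[OF summable_on_cmult_right[OF fs, of 2]])
      (auto intro!: mult_right_mono mult_nonneg_nonneg b2 f0)
  \<comment> \<open>Interchanging the order of summation is done on finite sets of cells only. The
    resulting uniform bound gives the summability of \<open>G\<close> as well as the comparison of
    the two infinite sums.\<close>
  have fin: "sum G A \<le> infsum (\<lambda>\<tau>. b \<tau> * f \<tau>) F" if A: "finite A" "A \<subseteq> F" for A
  proof -
    let ?P = "Sigma A top"
    define B where "B = (\<Union>(\<tau>,e)\<in>?P. cells e - {\<tau>})"
    have P: "finite ?P" using A top by auto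
    have B: "finite B" "B \<subseteq> F" using P A cells by (auto simp: B_def)
    have "sum G A = (\<Sum>(\<tau>,e)\<in>?P. \<Sum>\<tau>'\<in>cells e - {\<tau>}. f \<tau>')"
      unfolding G_def using A top by (subst sum.Sigma) auto
    \<comment> \<open>The inner index sets depend on the incidence. Extending each sum by zeros to
      the common finite set \<open>B\<close> allows the swap.\<close>
    also have "\<dots> = (\<Sum>p\<in>?P. \<Sum>\<tau>'\<in>B. if \<tau>' \<in> cells (snd p) - {fst p} then f \<tau>' else 0)"
      using B by (intro sum.cong)
        (auto simp: B_def sum.If_cases case_prod_beta intro!: sum.cong arg_cong[of _ _ "sum f"])
    also have "\<dots> = (\<Sum>\<tau>'\<in>B. \<Sum>p\<in>?P. if \<tau>' \<in> cells (snd p) - {fst p} then f \<tau>' else 0)"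
      by (rule sum.swap)
    also have "\<dots> \<le> (\<Sum>\<tau>'\<in>B. b \<tau>' * f \<tau>')"
    proof (rule sum_mono)
      fix \<tau>' assume "\<tau>' \<in> B"
      have "(\<Sum>p\<in>?P. if \<tau>' \<in> cells (snd p) - {fst p} then f \<tau>' else 0) =
          real (card {p \<in> ?P. \<tau>' \<in> cells (snd p) - {fst p}}) * f \<tau>'"
        using P by (simp add: sum.If_cases Int_def)
      also have "\<dots> \<le> b \<tau>' * f \<tau>'"
      proof (rule mult_right_mono)
        show "real (card {p \<in> ?P. \<tau>' \<in> cells (snd p) - {fst p}}) \<le> b \<tau>'"
          unfolding b_def using below[of \<tau>'] B A \<open>\<tau>' \<in> B\<close>
          by (intro of_nat_mono card_mono) (auto simp: below_def)
      qed (rule f0)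
      finally show "(\<Sum>p\<in>?P. if \<tau>' \<in> cells (snd p) - {fst p} then f \<tau>' else 0) \<le> b \<tau>' * f \<tau>'" .
    qed
    also have "\<dots> \<le> infsum (\<lambda>\<tau>. b \<tau> * f \<tau>) F"
      using B b2 f0 bfs by (intro finite_sum_le_infsum) (auto intro!: mult_nonneg_nonneg)
    finally show ?thesis .
  qed
  have Gs: "G summable_on F"
    using fin G0 by (intro nonneg_bdd_above_summable_on) (auto intro!: bdd_aboveI2)
  have "infsum G F \<le> infsum (\<lambda>\<tau>. b \<tau> * f \<tau>) F"
    using Gs fin by (rule infsum_le_finite_sums)
  \<comment> \<open>The two brackets are the defects in the Cauchy-Schwarz bound and in the bound
    \<open>b \<le> 2\<close>. Both are nonnegative and their total sum is at most 0, so each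
    vanishes at every cell.\<close>
  define d where "d \<tau> = (G \<tau> - 2 * f \<tau>) + (2 * f \<tau> - b \<tau> * f \<tau>)" for \<tau>
  have d: "G \<tau> - 2 * f \<tau> \<ge> 0" "2 * f \<tau> - b \<tau> * f \<tau> \<ge> 0" if "\<tau> \<in> F" for \<tau>
    using lower[OF that] mult_right_mono[OF b2(2)[OF that] f0] by auto
  have d_eq: "d = (\<lambda>\<tau>. G \<tau> - b \<tau> * f \<tau>)" by (auto simp: d_def)
  have nbfs: "(\<lambda>\<tau>. - (b \<tau> * f \<tau>)) summable_on F" using bfs by (simp only: summable_on_uminus)
  have ds: "d summable_on F" unfolding d_eq using summable_on_add[OF Gs nbfs] by simp
  have "infsum d F \<le> 0"
    unfolding d_eq using infsum_add[OF Gs nbfs] \<open>infsum G F \<le> _\<close>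
    by (simp add: infsum_uminus)
  then have d_zero: "d \<tau> = 0" if "\<tau> \<in> F" for \<tau>
    using nonneg_infsum_le_0D[of d F \<tau>] ds d that by (fastforce simp: d_def)
  show ?thesis
    using \<open>\<tau> \<in> F\<close>
  proof (induction "rank \<tau>" arbitrary: \<tau> rule: less_induct)
    case less
    have z: "2 * f \<tau> = b \<tau> * f \<tau>" using d_zero[OF less.prems] d[OF less.prems] by (simp add: d_def)
    show ?case
    proof (cases "below \<tau> = {}")
      case True
      then show ?thesis using z by (simp add: b_def f_def)
    next
      case False
      then obtain \<sigma> e where se: "(\<sigma>, e) \<in> below \<tau>" by auto
      then have s: "\<sigma> \<in> F" "e \<in> top \<sigma>" "\<tau> \<in> cells e - {\<sigma>}" by (auto simp: below_def)
      have "h \<sigma> = 0" using less.hyps rank[OF less.prems se] s by blast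
      then have "G \<sigma> = 0" using d_zero[OF s(1)] d[OF s(1)] by (simp add: d_def f_def)
      then have "(\<Sum>\<tau>'\<in>cells e - {\<sigma>}. f \<tau>') = 0"
        using s top[OF s(1)] by (simp add: G_def sum_nonneg_eq_0_iff sum_nonneg f0)
      then have "f \<tau> = 0"
        using s cells[OF s(1,2)] by (subst (asm) sum_nonneg_eq_0_iff) (auto simp: f0)
      then show ?thesis by (simp add: f_def)
    qed
  qed
qed

section \<open>Words, walls and lengths\<close>

lemma rev_in_lists [simp]: "rev w \<in> lists S \<longleftrightarrow> w \<in> lists S"
  by (simp add: in_lists_conv_set)

lemma concat_replicate_in_lists: "s \<in> S \<Longrightarrow> t \<in> S \<Longrightarrow> concat (replicate k [s, t]) \<in> lists S"
  by (induction k) auto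

lemma concat_replicate_commute: "concat (replicate k xs) @ xs = xs @ concat (replicate k xs)"
  by (induction k) simp_all

lemma rev_concat_replicate_pair:
  "rev (concat (replicate k [s, t])) = concat (replicate k [t, s])"
  using concat_replicate_commute[of _ "[t, s]"] by (induction k) simp_all

lemma snoc_concat_replicate_pair:
  "s # concat (replicate k [t, s]) = concat (replicate k [s, t]) @ [s]"
  by (induction k) simp_all

text \<open>A common form for the relators (even length) and for the words that lead to the vertices
  of a polygon (any length).\<close>

definition alt_word :: "'s \<Rightarrow> 's \<Rightarrow> nat \<Rightarrow> 's list" where
  "alt_word s t n = map (\<lambda>i. if even i then s else t) [0..<n]"

lemma length_alt_word [simp]: "length (alt_word s t n) = n"
  by (simp add: alt_word_def)

lemma alt_word_0 [simp]: "alt_word s t 0 = []"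
  by (simp add: alt_word_def)

lemma alt_word_Suc: "alt_word s t (Suc n) = alt_word s t n @ [if even n then s else t]"
  by (simp add: alt_word_def)

lemma alt_word_Suc_Cons: "alt_word s t (Suc n) = s # alt_word t s n"
  by (induction n) (simp_all add: alt_word_Suc)

lemma alt_word_append: "\<exists>w. alt_word s t (n + k) = alt_word s t n @ w"
  by (induction k) (auto simp: alt_word_Suc)

lemma alt_word_in_lists: "s \<in> A \<Longrightarrow> t \<in> A \<Longrightarrow> alt_word s t n \<in> lists A"
  by (auto simp: alt_word_def)

lemma concat_replicate_pair: "concat (replicate n [s, t]) = alt_word s t (2 * n)"
  by (induction n) (simp_all add: alt_word_Suc_Cons)

lemma take_concat_replicate_pair: "take n (concat (replicate n [s, t])) = alt_word s t n"
  by (simp add: concat_replicate_pair alt_word_def take_map)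

section \<open>Words modulo the Coxeter relations, and walls\<close>

locale coxeter_system =
  fixes S :: "'s set" and M :: "'s \<Rightarrow> 's \<Rightarrow> enat"
  assumes coxeter_matrix: "coxeter_matrix S M"
begin

abbreviation cox_equiv (infix "\<simeq>" 50) where "v \<simeq> w \<equiv> cox_eq S M v w"

lemma equiv_in_lists: "v \<simeq> w \<Longrightarrow> v \<in> lists S \<and> w \<in> lists S"
  by (induction rule: cox_eq.induct) (auto simp: concat_replicate_in_lists simp del: in_lists_conv_set)

lemma equiv_append_left: "v \<simeq> w \<Longrightarrow> x \<in> lists S \<Longrightarrow> x @ v \<simeq> x @ w"
proof (induction rule: cox_eq.induct)
  case (rel xs ys s t k)
  then show ?case
    using cox_eq.rel[of "x @ xs" S ys s t M k] by simp
next
  case (refl w)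
  then show ?case by (simp add: cox_eq.refl)
next
  case (sym v w)
  then show ?case by (simp add: cox_eq.sym)
next
  case (trans u v w)
  then show ?case using cox_eq.trans by blast
qed

lemma equiv_append_right: "v \<simeq> w \<Longrightarrow> x \<in> lists S \<Longrightarrow> v @ x \<simeq> w @ x"
proof (induction rule: cox_eq.induct)
  case (rel xs ys s t k)
  then show ?case
    using cox_eq.rel[of xs S "ys @ x" s t M k] by simp
next
  case (refl w)
  then show ?case by (simp add: cox_eq.refl)
next
  case (sym v w)
  then show ?case by (simp add: cox_eq.sym)
next
  case (trans u v w)
  then show ?case using cox_eq.trans by blast
qed

lemma equiv_append: "v \<simeq> w \<Longrightarrow> v' \<simeq> w' \<Longrightarrow> v @ v' \<simeq> w @ w'"
  using equiv_append_left equiv_append_right equiv_in_lists cox_eq.trans by metis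

lemma equiv_square: "s \<in> S \<Longrightarrow> [s, s] \<simeq> []"
  using cox_eq.rel[of "[]" S "[]" s s M 1] coxeter_matrix
  by (simp add: coxeter_matrix_def one_enat_def)

text \<open>Generators are involutions, so reversal represents inversion; conjugates are therefore
  written with \<open>rev\<close> throughout.\<close>

lemma equiv_append_rev: "w \<in> lists S \<Longrightarrow> w @ rev w \<simeq> []"
proof (induction w)
  case Nil
  then show ?case by (auto intro: cox_eq.refl)
next
  case (Cons s w)
  then have "[s] @ (w @ rev w) @ [s] \<simeq> [s] @ [] @ [s]"
    by (intro equiv_append cox_eq.refl) auto
  with Cons.prems equiv_square[of s] show ?case
    by (auto intro: cox_eq.trans)
qed

lemma equiv_rev_append: "w \<in> lists S \<Longrightarrow> rev w @ w \<simeq> []"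
  using equiv_append_rev[of "rev w"] by simp

lemma equiv_cancel_left:
  assumes "x \<in> lists S" "y \<in> lists S"
  shows "x @ rev x @ y \<simeq> y" "rev x @ x @ y \<simeq> y"
  using equiv_append_right[OF equiv_append_rev assms(2)]
    equiv_append_right[OF equiv_rev_append assms(2)] assms by auto

lemma equiv_cancel_right:
  assumes "x \<in> lists S" "y \<in> lists S"
  shows "y @ x @ rev x \<simeq> y" "y @ rev x @ x \<simeq> y"
  using equiv_append_left[OF equiv_append_rev assms(2)]
    equiv_append_left[OF equiv_rev_append assms(2)] assms by auto

lemma equiv_move_left:
  assumes "x \<in> lists S" "y \<in> lists S" "z \<in> lists S"
  shows "x @ y \<simeq> z \<longleftrightarrow> y \<simeq> rev x @ z"
proof
  assume "x @ y \<simeq> z"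
  then have "rev x @ x @ y \<simeq> rev x @ z" using assms by (intro equiv_append_left) auto
  then show "y \<simeq> rev x @ z"
    using equiv_cancel_left(2)[of x y] assms by (meson cox_eq.sym cox_eq.trans)
next
  assume "y \<simeq> rev x @ z"
  then have "x @ y \<simeq> x @ rev x @ z" using assms by (intro equiv_append_left) auto
  then show "x @ y \<simeq> z"
    using equiv_cancel_left(1)[of x z] assms by (meson cox_eq.sym cox_eq.trans)
qed

lemma equiv_move_right:
  assumes "x \<in> lists S" "y \<in> lists S" "z \<in> lists S"
  shows "y @ x \<simeq> z \<longleftrightarrow> y \<simeq> z @ rev x"
proof
  assume "y @ x \<simeq> z"
  then have "(y @ x) @ rev x \<simeq> z @ rev x" using assms by (intro equiv_append_right) auto
  then show "y \<simeq> z @ rev x"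
    using equiv_cancel_right(1)[of x y] assms by simp (meson cox_eq.sym cox_eq.trans)
next
  assume "y \<simeq> z @ rev x"
  then have "y @ x \<simeq> (z @ rev x) @ x" using assms by (intro equiv_append_right) auto
  then show "y @ x \<simeq> z"
    using equiv_cancel_right(2)[of x z] assms by simp (meson cox_eq.sym cox_eq.trans)
qed

lemma equiv_left_cancel:
  "x \<in> lists S \<Longrightarrow> y \<in> lists S \<Longrightarrow> z \<in> lists S \<Longrightarrow> x @ y \<simeq> x @ z \<longleftrightarrow> y \<simeq> z"
  using equiv_append_left equiv_move_left[of x y "x @ z"] equiv_cancel_left(2)[of x z]
  by (metis append_in_lists_conv cox_eq.trans)

lemma equiv_cong_iff: "v \<simeq> v' \<Longrightarrow> w \<simeq> w' \<Longrightarrow> v \<simeq> w \<longleftrightarrow> v' \<simeq> w'"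
  by (meson cox_eq.sym cox_eq.trans)

lemma equiv_rev: "v \<simeq> w \<Longrightarrow> rev v \<simeq> rev w"
  using equiv_move_left[of v "rev w" "[]"] equiv_move_right[of "rev w" v "[]"]
    equiv_in_lists[of v w] cox_eq.sym by fastforce

text \<open>All relators have even length. This is what later prevents a generator from preserving
  the length of an element.\<close>

lemma equiv_length_parity: "v \<simeq> w \<Longrightarrow> even (length v) \<longleftrightarrow> even (length w)"
  by (induction rule: cox_eq.induct) (auto simp: length_concat sum_list_replicate)

text \<open>Parity of the number of factorisations \<open>w = p s p'\<close> with \<open>r = p s p\<^sup>-\<^sup>1\<close>, that is, of the
  number of times the gallery \<open>w\<close> crosses the wall of \<open>r\<close>.\<close>
primrec crosses :: "'s list \<Rightarrow> 's list \<Rightarrow> bool" where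
  "crosses [] r = False"
| "crosses (s # w) r = ((r \<simeq> [s]) \<noteq> crosses w (s # r @ [s]))"

lemma crosses_cong: "r \<simeq> r' \<Longrightarrow> w \<in> lists S \<Longrightarrow> crosses w r = crosses w r'"
proof (induction w arbitrary: r r')
  case (Cons s w)
  have "s # r @ [s] \<simeq> s # r' @ [s]"
    using Cons.prems equiv_append_left[of "r @ [s]" "r' @ [s]" "[s]"] equiv_append_right[of r r' "[s]"]
    by auto
  then show ?case
    using Cons.IH Cons.prems equiv_cong_iff[OF Cons.prems(1) cox_eq.refl, of "[s]"] by auto
qed simp

lemma crosses_append: "crosses (v @ w) r = (crosses v r \<noteq> crosses w (rev v @ r @ v))"
  by (induction v arbitrary: r) auto

lemma equiv_conj_iff:
  assumes "x \<in> lists S" "r \<in> lists S" "z \<in> lists S"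
  shows "rev x @ r @ x \<simeq> z \<longleftrightarrow> r \<simeq> x @ z @ rev x"
  using assms equiv_move_left[of "rev x" "r @ x" z] equiv_move_right[of x r "x @ z"] by simp

text \<open>Conjugating letter number i of the alternating gallery by the prefix before it gives the
  palindrome (st)^i s, so the sum counts how often the wall of \<open>r\<close> occurs among the 2k
  crossings.\<close>

lemma crosses_alternating:
  assumes "s \<in> S" "t \<in> S" "r \<in> lists S"
  shows "crosses (concat (replicate k [s, t])) r =
    odd (\<Sum>i<2*k. of_bool (r \<simeq> concat (replicate i [s, t]) @ [s]) :: nat)"
proof (induction k)
  case (Suc k)
  let ?a = "\<lambda>k. concat (replicate k [s, t])"
  have a: "?a k \<in> lists S" for k using assms by (rule_tac concat_replicate_in_lists)
  have double: "?a k @ ?a k = ?a (2 * k)"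
    by (simp add: mult_2 replicate_add)
  have "rev (?a k) @ r @ ?a k \<simeq> [s] \<longleftrightarrow> r \<simeq> ?a (2 * k) @ [s]"
    using equiv_conj_iff[OF a assms(3), of "[s]" k] assms
    by (simp add: rev_concat_replicate_pair snoc_concat_replicate_pair flip: double)
  moreover have "s # rev (?a k) @ r @ ?a k @ [s] \<simeq> [t] \<longleftrightarrow> r \<simeq> ?a (Suc (2 * k)) @ [s]"
  proof -
    have "?a k @ [s, t, s] @ rev (?a k) = ?a k @ [s, t] @ ?a k @ [s]"
      by (simp add: rev_concat_replicate_pair snoc_concat_replicate_pair)
    also have "\<dots> = (?a k @ ?a (Suc k)) @ [s]" by simp
    also have "?a k @ ?a (Suc k) = ?a (Suc (2 * k))"
      by (simp flip: concat_append replicate_add add: mult_2 del: replicate_Suc)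
    finally show ?thesis
      using equiv_conj_iff[of "?a k @ [s]" r "[t]"] assms a by simp
  qed
  moreover have "?a (Suc k) = ?a k @ [s, t]" using concat_replicate_commute[of k "[s, t]"] by simp
  ultimately show ?case
    using Suc.IH by (simp add: crosses_append)
qed simp

text \<open>Since (st)^k = 1, the reflections (st)^i s are periodic in i with period k. The 2k
  letters run through two periods, so every wall is crossed an even number of times.\<close>

lemma crosses_relator:
  assumes "s \<in> S" "t \<in> S" "r \<in> lists S" "M s t = enat k"
  shows "\<not> crosses (concat (replicate k [s, t])) r"
proof -
  let ?a = "\<lambda>k. concat (replicate k [s, t])"
  let ?f = "\<lambda>i. of_bool (r \<simeq> ?a i @ [s]) :: nat"
  have per: "?f (i + k) = ?f i" for i
  proof -
    have "?a (i + k) @ [s] \<simeq> ?a i @ [s]"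
      using cox_eq.rel[OF concat_replicate_in_lists[of s S t i], of "[s]" s t M k] assms
      by (simp add: replicate_add)
    then have "r \<simeq> ?a (i + k) @ [s] \<longleftrightarrow> r \<simeq> ?a i @ [s]"
      using equiv_cong_iff cox_eq.refl[OF assms(3)] by blast
    then show ?thesis by simp
  qed
  have "(\<Sum>i<2*k. ?f i) = (\<Sum>i<k. ?f i) + (\<Sum>i=k..<2*k. ?f i)"
    using sum.union_disjoint[of "{..<k}" "{k..<2*k}" ?f]
    by (simp add: ivl_disj_int ivl_disj_un)
  also have "(\<Sum>i=k..<2*k. ?f i) = (\<Sum>i<k. ?f (i + k))"
    using sum.shift_bounds_nat_ivl[of ?f 0 k k] by (simp add: mult_2 atLeast0LessThan)
  finally have "even (\<Sum>i<2*k. ?f i)" by (simp only: per) simp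
  then show ?thesis by (simp only: crosses_alternating[OF assms(1-3)])  simp
qed

text \<open>Makes the parity a function of the group element. A relator contributes no crossing, and
  being trivial in the group it does not change the reflection that the remaining word is tested
  against.\<close>

lemma crosses_equiv: "v \<simeq> w \<Longrightarrow> r \<in> lists S \<Longrightarrow> crosses v r = crosses w r"
proof (induction rule: cox_eq.induct)
  case (rel xs ys s t k)
  let ?R = "concat (replicate k [s, t])" and ?r = "rev xs @ r @ xs"
  have l: "?r \<in> lists S" "?R \<in> lists S" using rel by (simp_all add: concat_replicate_in_lists)
  have R: "?R \<simeq> []" using cox_eq.rel[of "[]" S "[]" s t M k] rel by simp
  have "rev ?R @ ?r @ ?R \<simeq> [] @ ?r @ []"
    using equiv_rev[OF R] by (intro equiv_append R cox_eq.refl l) simp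
  then have "crosses ys (rev ?R @ ?r @ ?R) = crosses ys ?r"
    using crosses_cong[of _ _ ys] rel by simp
  moreover have "\<not> crosses ?R ?r" using crosses_relator rel l by blast
  ultimately show ?case by (simp add: crosses_append)
qed auto

text \<open>An odd count forces at least one crossing p s p^-1 = r, and left multiplication by r
  removes that letter s: folding the gallery along the wall. This is the exchange property.\<close>

lemma crosses_deletion:
  assumes "w \<in> lists S" "r \<in> lists S" "crosses w r"
  shows "\<exists>v\<in>lists (set w). Suc (length v) = length w \<and> r @ w \<simeq> v"
  using assms
proof (induction w arbitrary: r rule: list.induct)
  case (Cons s w)
  show ?case
  proof (cases "r \<simeq> [s]")
    case True
    have "r @ [s] @ w \<simeq> [s] @ [s] @ w"
      using True Cons.prems(1) by (intro equiv_append_right) auto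
    moreover have "[s] @ [s] @ w \<simeq> w" using equiv_cancel_left(1)[of "[s]" w] Cons.prems by simp
    ultimately show ?thesis
      by (intro bexI[of _ w]) (auto intro: cox_eq.trans)
  next
    case False
    then obtain v where v: "v \<in> lists (set w)" "Suc (length v) = length w" "(s # r @ [s]) @ w \<simeq> v"
      using Cons.IH[of "s # r @ [s]"] Cons.prems by auto
    have "v \<in> lists S" using v equiv_in_lists by blast
    then have "r @ s # w \<simeq> s # v"
      using equiv_move_left[of "[s]" "r @ s # w" v] v(3) Cons.prems by simp
    then show ?thesis using v by (intro bexI[of _ "s # v"]) auto
  qed
qed simp

text \<open>The contributions of \<open>p\<close> and \<open>rev p\<close> cancel, because
  \<open>p @ rev p\<close> is trivial and crosses nothing; the middle letter contributes one
  crossing.\<close>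

lemma crosses_own_wall:
  assumes "p \<in> lists S" "s \<in> S"
  shows "crosses (p @ [s] @ rev p) (p @ [s] @ rev p)"
proof -
  let ?r = "p @ [s] @ rev p"
  have r: "?r \<in> lists S" using assms by auto
  have c: "rev p @ ?r @ p \<simeq> [s]"
    using equiv_conj_iff[OF assms(1) r, of "[s]"] assms cox_eq.refl[OF r] by simp
  have "s # rev p @ ?r @ p @ [s] \<simeq> [s] @ [s] @ [s]"
    using equiv_append[OF cox_eq.refl equiv_append[OF c cox_eq.refl], of "[s]" "[s]"] assms by simp
  moreover have "[s] @ [s] @ [s] \<simeq> [s]" using equiv_cancel_left(1)[of "[s]" "[s]"] assms by simp
  ultimately have "s # rev p @ ?r @ p @ [s] \<simeq> rev p @ ?r @ p"
    using c by (meson cox_eq.trans cox_eq.sym)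
  then have "crosses (rev p) (s # rev p @ ?r @ p @ [s]) = crosses (rev p) (rev p @ ?r @ p)"
    by (rule crosses_cong) (use assms in auto)
  moreover have "crosses (p @ rev p) ?r = crosses [] ?r"
    using crosses_equiv[OF equiv_append_rev r] assms by simp
  ultimately show ?thesis
    using c by (simp add: crosses_append)
qed

section \<open>Length, reduced words and deletion\<close>

abbreviation cls :: "'s list \<Rightarrow> 's list set" where "cls \<equiv> cox_class S M"
abbreviation len :: "'s list \<Rightarrow> nat" where "len w \<equiv> cox_length S M (cls w)"

lemma cls_eq_iff: "v \<in> lists S \<Longrightarrow> w \<in> lists S \<Longrightarrow> cls v = cls w \<longleftrightarrow> v \<simeq> w"
proof
  assume "v \<in> lists S" "cls v = cls w"
  then have "v \<in> cls w" using cox_eq.refl[of v S M] by (auto simp: cox_class_def)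
  then show "v \<simeq> w" by (simp add: cox_class_def)
next
  assume "v \<simeq> w"
  then have "x \<simeq> v \<longleftrightarrow> x \<simeq> w" for x by (meson cox_eq.sym cox_eq.trans)
  then show "cls v = cls w" by (simp add: cox_class_def)
qed

lemma cls_eq: "v \<simeq> w \<Longrightarrow> cls v = cls w"
  using cls_eq_iff equiv_in_lists by blast

lemma len_equiv: "v \<simeq> w \<Longrightarrow> len v = len w"
  by (simp add: cls_eq)

lemma len_le_length: "v \<simeq> w \<Longrightarrow> len w \<le> length v"
  unfolding cox_length_def cox_class_def using equiv_in_lists by (intro Least_le) blast

lemma reduced_word_exists: "w \<in> lists S \<Longrightarrow> \<exists>v. v \<simeq> w \<and> length v = len w"
proof -
  assume "w \<in> lists S"
  then have "\<exists>n. \<exists>v\<in>cls w. length v = n" using cox_eq.refl by (force simp: cox_class_def)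
  then have "\<exists>v\<in>cls w. length v = len w" unfolding cox_length_def by (rule LeastI_ex)
  then show ?thesis by (auto simp: cox_class_def)
qed

lemma len_parity: "w \<in> lists S \<Longrightarrow> even (len w) \<longleftrightarrow> even (length w)"
  using reduced_word_exists equiv_length_parity by metis

lemma len_append_le: "v \<in> lists S \<Longrightarrow> w \<in> lists S \<Longrightarrow> len (v @ w) \<le> len v + length w"
  using reduced_word_exists[of v] equiv_append_right[of _ v w] len_le_length
  by (metis length_append)

lemma len_snoc_cases:
  assumes "w \<in> lists S" "s \<in> S"
  shows "len (w @ [s]) = Suc (len w) \<or> len w = Suc (len (w @ [s]))"
proof -
  have "len (w @ [s]) \<le> Suc (len w)" using len_append_le[of w "[s]"] assms by simp
  moreover have "len w = len (w @ [s] @ [s])"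
    using equiv_cancel_right(1)[of "[s]" w] len_equiv assms by fastforce
  then have "len w \<le> Suc (len (w @ [s]))" using len_append_le[of "w @ [s]" "[s]"] assms by simp
  moreover have "len w \<noteq> len (w @ [s])"
    using len_parity[of w] len_parity[of "w @ [s]"] assms by auto
  ultimately show ?thesis by linarith
qed

lemma crosses_len_less:
  assumes "w \<in> lists S" "r \<in> lists S" "crosses w r"
  shows "len (r @ w) < len w"
proof -
  obtain v where v: "v \<simeq> w" "length v = len w" using reduced_word_exists assms by blast
  then obtain v' where v': "Suc (length v') = length v" "r @ v \<simeq> v'"
    using crosses_deletion[of v r] crosses_equiv[OF v(1)] assms equiv_in_lists by blast
  have "v' \<simeq> r @ w" using v v' equiv_append_left assms cox_eq.sym cox_eq.trans by meson
  then show ?thesis using len_le_length v v' by fastforce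
qed

text \<open>If \<open>w\<close> did not cross the wall of \<open>r\<close>, then
  \<open>r @ w\<close> would, since \<open>r\<close> crosses its own wall. Multiplying by
  \<open>r\<close> again would then shorten \<open>r @ w\<close> to \<open>w\<close>, against the
  assumed inequality.\<close>

lemma crosses_reflection_iff:
  assumes "w \<in> lists S" "p \<in> lists S" "s \<in> S" and r: "r = p @ [s] @ rev p"
  shows "crosses w r \<longleftrightarrow> len (r @ w) < len w"
proof
  assume less: "len (r @ w) < len w"
  show "crosses w r"
  proof (rule ccontr)
    assume n: "\<not> crosses w r"
    have rS: "r \<in> lists S" and [simp]: "rev r = r" using assms by auto
    have "crosses (r @ w) r = (crosses r r \<noteq> crosses w (r @ r @ r))"
      by (simp add: crosses_append)
    also have "crosses w (r @ r @ r) = crosses w r"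
      using equiv_cancel_left(1)[of r r] rS assms(1) by (intro crosses_cong) auto
    finally have "crosses (r @ w) r" using n crosses_own_wall assms by simp
    then have "len (r @ r @ w) < len (r @ w)"
      using crosses_len_less[of "r @ w" r] rS assms by simp
    moreover have "len (r @ r @ w) = len w"
      using equiv_cancel_left(1)[of r w] rS assms by (intro len_equiv) auto
    ultimately show False using less by simp
  qed
qed (use crosses_len_less[of w r] assms in auto)

lemma crosses_descent_iff:
  assumes "w \<in> lists S" "s \<in> S"
  shows "crosses w (w @ [s] @ rev w) \<longleftrightarrow> len (w @ [s]) < len w"
  using crosses_reflection_iff[OF assms(1) assms HOL.refl]
    len_equiv[OF equiv_cancel_right(2)[of w "w @ [s]"]] assms by simp

definition reduced :: "'s list \<Rightarrow> bool" where
  "reduced w \<longleftrightarrow> w \<in> lists S \<and> length w = len w"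

lemma reduced_append:
  assumes "reduced (v @ w)" shows "reduced v" "reduced w"
proof -
  have vw: "v \<in> lists S" "w \<in> lists S" using assms by (auto simp: reduced_def)
  then obtain v' where v': "v' \<simeq> v" "length v' = len v" using reduced_word_exists by blast
  obtain w' where w': "w' \<simeq> w" "length w' = len w" using vw reduced_word_exists by blast
  have "len (v @ w) \<le> len v + len w"
    using len_le_length[OF equiv_append[OF v'(1) w'(1)]] v' w' by simp
  moreover have "len v \<le> length v" "len w \<le> length w" using vw by (auto intro: len_le_length cox_eq.refl)
  ultimately show "reduced v" "reduced w" using assms vw by (auto simp: reduced_def)
qed

text \<open>At the end of the longest reduced prefix the next letter is a descent, so the deletion
  property applies there. Keeping the letters inside \<open>set w\<close> ensures that shortening a
  word over a subset of generators stays over that subset.\<close>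

lemma non_reduced_shortening:
  assumes "w \<in> lists S" "\<not> reduced w"
  shows "\<exists>v\<in>lists (set w). length v < length w \<and> v \<simeq> w"
  using assms
proof (induction w rule: rev_induct)
  case Nil
  then show ?case using len_le_length[OF cox_eq.refl, of "[]"] by (simp add: reduced_def)
next
  case (snoc s w)
  show ?case
  proof (cases "reduced w")
    case True
    then have "len (w @ [s]) < len w"
      using snoc.prems len_snoc_cases[of w s] by (auto simp: reduced_def)
    then have "crosses w (w @ [s] @ rev w)" using crosses_descent_iff snoc.prems by simp
    then obtain v where v: "v \<in> lists (set w)" "Suc (length v) = length w" "(w @ [s] @ rev w) @ w \<simeq> v"
      using crosses_deletion[of w "w @ [s] @ rev w"] snoc.prems by auto
    moreover have "(w @ [s]) @ rev w @ w \<simeq> w @ [s]"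
      using snoc.prems by (intro equiv_cancel_right) auto
    ultimately have "v \<simeq> w @ [s]" using cox_eq.sym cox_eq.trans by fastforce
    then show ?thesis using v by (intro bexI[of _ v]) auto
  next
    case False
    then obtain v where "v \<in> lists (set w)" "length v < length w" "v \<simeq> w"
      using snoc by auto
    then show ?thesis using snoc.prems equiv_append_right[of v w "[s]"]
      by (intro bexI[of _ "v @ [s]"]) auto
  qed
qed

lemma reduced_word_in_subset:
  assumes "T \<subseteq> S" "w \<in> lists T"
  shows "\<exists>v\<in>lists T. reduced v \<and> v \<simeq> w"
  using assms(2)
proof (induction "length w" arbitrary: w rule: less_induct)
  case less
  have wS: "w \<in> lists S" using less.prems assms(1) by auto
  show ?case
  proof (cases "reduced w")
    case False
    then obtain v where v: "v \<in> lists (set w)" "length v < length w" "v \<simeq> w"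
      using non_reduced_shortening wS by blast
    have "v \<in> lists T" using v(1) less.prems by auto
    then obtain v' where v': "v' \<in> lists T" "reduced v'" "v' \<simeq> v"
      using less.hyps[OF v(2)] by auto
    then show ?thesis using cox_eq.trans[OF v'(3) v(3)] by auto
  next
    case True
    then show ?thesis using less.prems cox_eq.refl[OF wS] by auto
  qed
qed

text \<open>Suppose the last letter s of \<open>a @ [s]\<close> shortened u a. Then u a crosses the
  wall of u a s a^-1 u^-1. The part \<open>a\<close> does not account for it, because
  \<open>a @ [s]\<close> is reduced, so \<open>u\<close> crosses this wall; reflecting shows that u
  a s a^-1 is shorter than u, against minimality in the coset.\<close>

lemma len_minimal_append:
  assumes T: "T \<subseteq> S" and u: "u \<in> lists S" and min: "\<And>b. b \<in> lists T \<Longrightarrow> len u \<le> len (u @ b)"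
  shows "a \<in> lists T \<Longrightarrow> reduced a \<Longrightarrow> len (u @ a) = len u + length a"
proof (induction a rule: rev_induct)
  case (snoc s a)
  have aS: "a \<in> lists S" "s \<in> S" using snoc.prems T by auto
  have IH: "len (u @ a) = len u + length a" using snoc reduced_append[of a "[s]"] by auto
  show ?case
  proof (rule ccontr)
    assume "len (u @ a @ [s]) \<noteq> len u + length (a @ [s])"
    then have "len ((u @ a) @ [s]) < len (u @ a)"
      using len_snoc_cases[of "u @ a" s] IH aS u by auto
    then have "crosses (u @ a) ((u @ a) @ [s] @ rev (u @ a))"
      using crosses_descent_iff[of "u @ a" s] aS u by simp
    then have cr: "crosses u (u @ (a @ [s] @ rev a) @ rev u) \<noteq>
        crosses a (rev u @ (u @ (a @ [s] @ rev a) @ rev u) @ u)"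
      by (simp add: crosses_append)
    have "rev u @ (u @ (a @ [s] @ rev a) @ rev u) @ u \<simeq> a @ [s] @ rev a"
      using equiv_conj_iff[of u "u @ (a @ [s] @ rev a) @ rev u" "a @ [s] @ rev a"]
        cox_eq.refl[of "u @ (a @ [s] @ rev a) @ rev u" S M] u aS by simp
    then have "crosses a (rev u @ (u @ (a @ [s] @ rev a) @ rev u) @ u) = crosses a (a @ [s] @ rev a)"
      by (rule crosses_cong) (use aS in auto)
    also have "\<not> \<dots>"
      using crosses_descent_iff[OF aS] snoc.prems reduced_append[of a "[s]"] by (simp add: reduced_def)
    finally have "crosses u (u @ (a @ [s] @ rev a) @ rev u)" using cr by blast
    then have "len ((u @ (a @ [s] @ rev a) @ rev u) @ u) < len u"
      using u aS by (intro crosses_len_less) auto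
    moreover have "len ((u @ (a @ [s] @ rev a) @ rev u) @ u) = len (u @ a @ [s] @ rev a)"
      using equiv_cancel_right(2)[of u "u @ a @ [s] @ rev a"] u aS by (intro len_equiv) auto
    ultimately show False using min[of "a @ [s] @ rev a"] snoc.prems by auto
  qed
qed simp

subsection \<open>Dihedral subgroups\<close>

lemma not_reducedI: "v \<simeq> w \<Longrightarrow> length v < length w \<Longrightarrow> \<not> reduced w"
  using len_le_length[of v w] by (auto simp: reduced_def)

lemma reduced_Cons_alternating:
  "set w \<subseteq> {s, t} \<Longrightarrow> reduced (s # w) \<Longrightarrow> s # w = alt_word s t (Suc (length w))"
proof (induction w arbitrary: s t)
  case Nil
  then show ?case by (simp add: alt_word_Suc)
next
  case (Cons a w)
  have "\<not> reduced [s, s]"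
    using equiv_square[of s] by (cases "s \<in> S") (auto simp: reduced_def intro: not_reducedI cox_eq.sym dest: len_le_length[OF cox_eq.sym])
  then have "a \<noteq> s" using Cons.prems reduced_append(1)[of "[s, a]" w] by auto
  then have "a = t" using Cons.prems by auto
  moreover have "reduced (a # w)" using Cons.prems reduced_append(2)[of "[s]" "a # w"] by simp
  ultimately have "t # w = alt_word t s (Suc (length w))"
    using Cons.IH[of t s] Cons.prems by auto
  then show ?case using \<open>a = t\<close> by (simp add: alt_word_Suc_Cons[of s t])
qed

lemma reduced_alternating:
  assumes "w \<in> lists {s, t}" "reduced w"
  shows "w = alt_word s t (length w) \<or> w = alt_word t s (length w)"
proof (cases w)
  case (Cons a v)
  then show ?thesis
    using assms reduced_Cons_alternating[of v s t] reduced_Cons_alternating[of v t s]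
    by (auto simp: insert_commute)
qed simp

lemma reduced_alt_word_le: "reduced (alt_word s t k) \<Longrightarrow> n \<le> k \<Longrightarrow> reduced (alt_word s t n)"
  using alt_word_append[of s t n "k - n"] reduced_append(1) by force

text \<open>Reduced words in two letters alternate, and prefixes of reduced words are reduced. One
  non-reduced alternating word of each kind thus bounds the length of all reduced words.\<close>

lemma finite_dihedral:
  assumes S: "s \<in> S" "t \<in> S" and "\<not> reduced (alt_word s t n)" "\<not> reduced (alt_word t s n)"
  shows "finite (special_subgroup S M {s, t})"
proof (rule finite_subset)
  show "special_subgroup S M {s, t} \<subseteq> cls ` {w. set w \<subseteq> {s, t} \<and> length w \<le> n}"
  proof
    fix X assume "X \<in> special_subgroup S M {s, t}"
    then obtain w where w: "w \<in> lists {s, t}" "X = cls w" by (auto simp: special_subgroup_def)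
    obtain v where v: "v \<in> lists {s, t}" "reduced v" "v \<simeq> w"
      using reduced_word_in_subset[of "{s, t}" w] w S by auto
    have "length v \<le> n"
      using reduced_alternating[OF v(1,2)] v(2) assms(3,4) reduced_alt_word_le
      by (metis nle_le)
    then show "X \<in> cls ` {w. set w \<subseteq> {s, t} \<and> length w \<le> n}"
      using v cls_eq[OF v(3)] w by (intro image_eqI[of _ _ v]) auto
  qed
  show "finite (cls ` {w. set w \<subseteq> {s, t} \<and> length w \<le> n})"
    by (intro finite_imageI finite_lists_length_le) simp
qed

lemma alt_word_relator:
  assumes "s \<in> S" "t \<in> S" "M s t = enat k"
  shows "alt_word s t (2 * k) \<simeq> []" "alt_word t s (2 * k) \<simeq> []"
proof -
  have "concat (replicate k [s, t]) \<simeq> []"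
    using cox_eq.rel[of "[]" S "[]" s t M k] assms by simp
  then show "alt_word s t (2 * k) \<simeq> []" "alt_word t s (2 * k) \<simeq> []"
    using equiv_rev[of "concat (replicate k [s, t])" "[]"]
    by (simp_all add: rev_concat_replicate_pair flip: concat_replicate_pair)
qed

lemma finite_label_finite_dihedral:
  assumes "s \<in> S" "t \<in> S" "M s t = enat k" "k > 0"
  shows "finite (special_subgroup S M {s, t})"
  using alt_word_relator[OF assms(1-3), THEN cox_eq.sym, THEN not_reducedI] assms
  by (intro finite_dihedral[of _ _ "2 * k"]) simp_all

section \<open>Minimal coset representatives and descents\<close>

definition coset_minimal :: "'s set \<Rightarrow> 's list \<Rightarrow> bool" where
  "coset_minimal T u \<longleftrightarrow> u \<in> lists S \<and> (\<forall>b\<in>lists T. len u \<le> len (u @ b))"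

lemma coset_minimal_len:
  "T \<subseteq> S \<Longrightarrow> coset_minimal T u \<Longrightarrow> a \<in> lists T \<Longrightarrow> reduced a \<Longrightarrow> len (u @ a) = len u + length a"
  using len_minimal_append by (simp add: coset_minimal_def)

lemma coset_minimal_decomposition:
  assumes T: "T \<subseteq> S" and x: "x \<in> lists S"
  obtains u a where "coset_minimal T u" "a \<in> lists T" "reduced a" "x \<simeq> u @ a"
proof -
  obtain b where b: "b \<in> lists T" "\<And>c. c \<in> lists T \<Longrightarrow> len (x @ b) \<le> len (x @ c)"
    using ex_has_least_nat[of "\<lambda>b. b \<in> lists T" "[]" "\<lambda>b. len (x @ b)"] by auto
  have bS: "b \<in> lists S" using b(1) T by auto
  have min: "coset_minimal T (x @ b)"
    using b x bS by (simp add: coset_minimal_def)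
  obtain a where a: "a \<in> lists T" "reduced a" "a \<simeq> rev b"
    using reduced_word_in_subset[OF T, of "rev b"] b by auto
  have "(x @ b) @ rev b \<simeq> x" using equiv_cancel_right(1)[OF bS x] by simp
  moreover have "(x @ b) @ a \<simeq> (x @ b) @ rev b" using a x bS by (intro equiv_append_left) auto
  ultimately have "x \<simeq> (x @ b) @ a" by (meson cox_eq.sym cox_eq.trans)
  with min a that show ?thesis by blast
qed

text \<open>Write x = u a with u minimal and a reduced. Then a is nonempty, and its last letter is
  the descent because lengths add along the coset.\<close>

lemma descent_if_not_coset_minimal:
  assumes T: "T \<subseteq> S" and x: "x \<in> lists S" and "\<not> coset_minimal T x"
  shows "\<exists>s\<in>T. len (x @ [s]) < len x"
proof -
  obtain u a where ua: "coset_minimal T u" "a \<in> lists T" "reduced a" "x \<simeq> u @ a"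
    using coset_minimal_decomposition[OF T x] .
  have "a \<noteq> []"
  proof
    assume "a = []"
    then have "len (x @ b) = len (u @ b)" if "b \<in> lists T" for b
      using ua that T by (intro len_equiv equiv_append_right) auto
    from this[of "[]"] this show False
      using assms(3) ua(1) x by (simp add: coset_minimal_def)
  qed
  then obtain a' s where a: "a = a' @ [s]" by (cases a rule: rev_cases) auto
  have s: "s \<in> T" "s \<in> S" "a' \<in> lists T" "a' \<in> lists S" "u \<in> lists S"
    using ua a T by (auto simp: coset_minimal_def)
  have "x @ [s] \<simeq> (u @ a) @ [s]" using ua s by (intro equiv_append_right) auto
  moreover have "(u @ a') @ [s] @ rev [s] \<simeq> u @ a'" using s by (intro equiv_cancel_right) auto
  ultimately have "len (x @ [s]) = len (u @ a')" using a by (intro len_equiv) (auto intro: cox_eq.trans)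
  moreover have "len (u @ a') = len u + length a'"
    using coset_minimal_len[OF T ua(1)] s reduced_append ua(3) a by blast
  moreover have "len x = len u + length a"
    using coset_minimal_len[OF T ua(1-3)] len_equiv[OF ua(4)] by simp
  ultimately show ?thesis using a by (intro bexI[OF _ s(1)]) simp
qed

lemma coset_minimal_unique:
  assumes T: "T \<subseteq> S" and u: "coset_minimal T u" and b: "b \<in> lists T" and le: "len (u @ b) \<le> len u"
  shows "b \<simeq> []"
proof -
  obtain a where a: "a \<in> lists T" "reduced a" "a \<simeq> b" using reduced_word_in_subset[OF T b] by blast
  have "u @ a \<simeq> u @ b" using a u by (intro equiv_append_left) (auto simp: coset_minimal_def)
  then have "len u + length a = len (u @ b)"
    using coset_minimal_len[OF T u a(1,2)] len_equiv by simp
  then have "a = []" using le by (cases a) auto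
  then show ?thesis using cox_eq.sym[OF a(3)] by simp
qed

text \<open>Additivity of lengths along the coset transfers the descent from u a to a. A reduced
  word for a s, extended by s, then has the length of a.\<close>

lemma descent_reduced_word:
  assumes T: "T \<subseteq> S" and u: "coset_minimal T u" and a: "a \<in> lists T" "reduced a"
    and s: "s \<in> T" "len (u @ a @ [s]) < len (u @ a)"
  obtains b where "b @ [s] \<in> lists T" "reduced (b @ [s])" "b @ [s] \<simeq> a" "length (b @ [s]) = length a"
proof -
  have S: "s \<in> S" "a \<in> lists S" "u \<in> lists S" using T s a u by (auto simp: coset_minimal_def)
  obtain b where b: "b \<in> lists T" "reduced b" "b \<simeq> a @ [s]"
    using reduced_word_in_subset[OF T, of "a @ [s]"] a s by auto
  have "len (u @ b) = len (u @ a @ [s])"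
    using b S by (intro len_equiv equiv_append_left) auto
  then have "length b < length a"
    using coset_minimal_len[OF T u a] coset_minimal_len[OF T u b(1,2)] s(2) by simp
  moreover have "length b = len (a @ [s])" using b len_equiv by (simp add: reduced_def)
  ultimately have l: "length (b @ [s]) = length a"
    using len_snoc_cases[OF S(2,1)] a(2) by (auto simp: reduced_def)
  have "b @ [s] \<simeq> (a @ [s]) @ [s]" using b S by (intro equiv_append_right) auto
  then have e: "b @ [s] \<simeq> a"
    using equiv_cancel_right(1)[of "[s]" a] S by (auto intro: cox_eq.trans)
  then have "reduced (b @ [s])" using l a(2) len_equiv[OF e] equiv_in_lists[OF e] by (simp add: reduced_def)
  with that e l b s show ?thesis by auto
qed

text \<open>The dihedral part of x has reduced words ending in s and in t. They are the two
  alternating words of one length n + 1, so these agree in the group, and prefixing a letter to this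
  equality shows that both alternating words of length n + 2 have length at most n.\<close>

lemma two_descents_finite_dihedral:
  assumes S: "s \<in> S" "t \<in> S" "s \<noteq> t" and x: "x \<in> lists S"
    and desc: "len (x @ [s]) < len x" "len (x @ [t]) < len x"
  shows "finite (special_subgroup S M {s, t})"
proof -
  have T: "{s, t} \<subseteq> S" using S by simp
  obtain u a where ua: "coset_minimal {s, t} u" "a \<in> lists {s, t}" "reduced a" "x \<simeq> u @ a"
    using coset_minimal_decomposition[OF T x] .
  have len_r: "len (x @ [r]) = len (u @ a @ [r])" if "r \<in> S" for r
    using equiv_append_right[OF ua(4), of "[r]"] that len_equiv by simp
  have d: "len (u @ a @ [r]) < len (u @ a)" if "r \<in> {s, t}" for r
    using that desc len_r[of r] S len_equiv[OF ua(4)] by auto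
  obtain b where b: "b @ [s] \<in> lists {s, t}" "reduced (b @ [s])" "b @ [s] \<simeq> a" "length (b @ [s]) = length a"
    using descent_reduced_word[OF T ua(1-3)] d by blast
  obtain c where c: "c @ [t] \<in> lists {s, t}" "reduced (c @ [t])" "c @ [t] \<simeq> a" "length (c @ [t]) = length a"
    using descent_reduced_word[OF T ua(1-3)] d by blast
  define n where "n = length b"
  have len: "length (b @ [s]) = Suc n" "length (c @ [t]) = Suc n" using b(4) c(4) by (auto simp: n_def)
  have "b @ [s] \<noteq> c @ [t]" using S by simp
  moreover have "b @ [s] \<simeq> c @ [t]" using b(3) c(3) cox_eq.sym cox_eq.trans by meson
  moreover have "b @ [s] = alt_word s t (Suc n) \<or> b @ [s] = alt_word t s (Suc n)"
    using reduced_alternating[OF b(1,2)] len by simp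
  moreover have "c @ [t] = alt_word s t (Suc n) \<or> c @ [t] = alt_word t s (Suc n)"
    using reduced_alternating[OF c(1,2)] len by simp
  ultimately have e: "alt_word s t (Suc n) \<simeq> alt_word t s (Suc n)"
    using cox_eq.sym by metis
  have nr: "\<not> reduced (alt_word s t (Suc (Suc n)))"
    if "s \<in> S" "t \<in> S" "alt_word s t (Suc n) \<simeq> alt_word t s (Suc n)" for s t
  proof -
    have "[s] @ alt_word s t (Suc n) \<simeq> [s] @ alt_word t s (Suc n)"
      using that by (intro equiv_append_left) auto
    moreover have "[s] @ rev [s] @ alt_word t s n \<simeq> alt_word t s n"
      using that by (intro equiv_cancel_left alt_word_in_lists) auto
    ultimately have "alt_word t s n \<simeq> [s] @ alt_word t s (Suc n)"
      by (simp add: alt_word_Suc_Cons) (meson cox_eq.sym cox_eq.trans)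
    then show ?thesis by (intro not_reducedI) (auto simp: alt_word_Suc_Cons)
  qed
  show ?thesis
    using nr[of s t] nr[of t s] e cox_eq.sym S by (intro finite_dihedral[of _ _ "Suc (Suc n)"]) auto
qed

text \<open>The generator \<open>s\<close> acts on the integers as the reflection \<open>x \<mapsto> a s - x\<close>. The product
  of two such reflections is a translation, so modulo \<open>m\<close> this is an action of a Coxeter group
  with all finite labels equal to \<open>m\<close>.\<close>
definition dihedral_action :: "('s \<Rightarrow> int) \<Rightarrow> 's list \<Rightarrow> int \<Rightarrow> int" where
  "dihedral_action a w x = foldr (\<lambda>s x. a s - x) w x"

lemma dihedral_action_append:
  "dihedral_action a (v @ w) x = dihedral_action a v (dihedral_action a w x)"
  by (simp add: dihedral_action_def)

lemma dihedral_action_relator: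
  "dihedral_action a (concat (replicate k [s, t])) x = x + int k * (a s - a t)"
  by (induction k) (auto simp: dihedral_action_def algebra_simps)

lemma dihedral_action_mod:
  "x mod n = y mod n \<Longrightarrow> dihedral_action a w x mod n = dihedral_action a w y mod n"
proof (induction w)
  case (Cons s w)
  then show ?case by (simp add: dihedral_action_def) (rule mod_diff_cong, simp_all)
qed (simp add: dihedral_action_def)

lemma dihedral_action_equiv:
  assumes labels: "\<And>s t k. s \<in> S \<Longrightarrow> t \<in> S \<Longrightarrow> s \<noteq> t \<Longrightarrow> M s t = enat k \<Longrightarrow> k = m"
    and "v \<simeq> w"
  shows "dihedral_action a v x mod int m = dihedral_action a w x mod int m"
  using assms(2)
proof (induction arbitrary: x rule: cox_eq.induct)
  case (rel xs ys s t k)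
  have "(y + int k * (a s - a t)) mod int m = y mod int m" for y
    using labels rel by (cases "s = t") auto
  then show ?case
    by (simp only: dihedral_action_append dihedral_action_relator) (rule dihedral_action_mod)
qed auto

text \<open>The relations alone only bound the order of st from above; distinctness needs an action
  in which st has order m.\<close>

lemma alt_word_inj:
  assumes labels: "\<And>s t k. s \<in> S \<Longrightarrow> t \<in> S \<Longrightarrow> s \<noteq> t \<Longrightarrow> M s t = enat k \<Longrightarrow> k = m"
    and "s \<noteq> t" "i < 2 * m" "j < 2 * m" "alt_word s t i \<simeq> alt_word s t j"
  shows "i = j"
proof -
  \<comment> \<open>With this choice \<open>?a s - ?a t = 1\<close>, so st translates by 1. Length
    parity separates even from odd words, and the image of 0 modulo m separates words within each
    parity.\<close>
  let ?a = "\<lambda>r. if r = s then 1 else 0 :: int"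
  have even_val: "dihedral_action ?a (alt_word s t (2 * k)) x = x + int k" for k x
    using dihedral_action_relator[of ?a k s t x] assms(2) by (simp add: concat_replicate_pair)
  have odd_val: "dihedral_action ?a (alt_word s t (Suc (2 * k))) 0 = 1 + int k" for k
    by (simp add: alt_word_Suc dihedral_action_append even_val) (simp add: dihedral_action_def)
  have par: "even i \<longleftrightarrow> even j" using equiv_length_parity[OF assms(5)] by simp
  have eq: "dihedral_action ?a (alt_word s t i) 0 mod int m = dihedral_action ?a (alt_word s t j) 0 mod int m"
    by (rule dihedral_action_equiv) (use labels assms(5) in auto)
  show ?thesis
  proof (cases "even i")
    case True
    then obtain k l where kl: "i = 2 * k" "j = 2 * l" using par by (auto elim!: evenE)
    then have "int k mod int m = int l mod int m" using eq even_val[of _ 0] by simp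
    then show ?thesis using kl assms(3,4) by simp
  next
    case False
    then obtain k l where kl: "i = Suc (2 * k)" "j = Suc (2 * l)" using par by (auto elim!: oddE)
    then have "(1 + int k) mod int m = (1 + int l) mod int m" using eq odd_val by simp
    then have "(1 + int k - 1) mod int m = (1 + int l - 1) mod int m" by (rule mod_diff_cong) simp
    then have "int k mod int m = int l mod int m" by simp
    then show ?thesis using kl assms(3,4) by simp
  qed
qed

section \<open>Cells of the Davis complex\<close>

lemma cls_in_cox_group: "x \<in> lists S \<Longrightarrow> cls x \<in> cox_group S M"
  by (simp add: cox_group_def)

lemma cox_mult_cls:
  assumes "x \<in> lists S" "y \<in> lists S"
  shows "cox_mult S M (cls x) (cls y) = cls (x @ y)"
proof -
  have some: "(SOME v. v \<in> cls w) \<simeq> w" if "w \<in> lists S" for w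
  proof -
    have "w \<in> cls w" using that cox_eq.refl[OF that] by (simp add: cox_class_def)
    then have "(SOME v. v \<in> cls w) \<in> cls w" by (rule someI)
    then show ?thesis by (simp add: cox_class_def)
  qed
  show ?thesis
    unfolding cox_mult_def by (intro cls_eq equiv_append some assms)
qed

lemma cox_coset_cls:
  assumes "T \<subseteq> S" "x \<in> lists S"
  shows "cox_coset S M T (cls x) = (\<lambda>a. cls (x @ a)) ` lists T"
proof -
  have "a \<in> lists S" if "a \<in> lists T" for a using that assms by auto
  then have "cox_mult S M (cls x) (cls a) = cls (x @ a)" if "a \<in> lists T" for a
    using cox_mult_cls assms(2) that by blast
  moreover have "cox_coset S M T (cls x) = (\<lambda>a. cox_mult S M (cls x) (cls a)) ` lists T"
    unfolding cox_coset_def special_subgroup_def by blast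
  ultimately show ?thesis by simp
qed

lemma coset_member_eq:
  assumes T: "T \<subseteq> S" and x: "x \<in> lists S" and y: "y \<in> lists S"
    and mem: "cls y \<in> (\<lambda>a. cls (x @ a)) ` lists T"
  shows "(\<lambda>a. cls (x @ a)) ` lists T = (\<lambda>a. cls (y @ a)) ` lists T"
proof -
  obtain a where a: "a \<in> lists T" "cls y = cls (x @ a)" using mem by auto
  have aS: "a \<in> lists S" using a T by auto
  have ya: "y \<simeq> x @ a" using a(2) cls_eq_iff x y aS by simp
  have fwd: "cls (y @ b) = cls (x @ a @ b)" if "b \<in> lists T" for b
    using equiv_append_right[OF ya, of b] that T by (intro cls_eq) auto
  have inv: "cls (x @ b) = cls (y @ rev a @ b)" if "b \<in> lists T" for b
  proof -
    have bS: "b \<in> lists S" using that T by auto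
    have "y @ rev a @ b \<simeq> (x @ a) @ rev a @ b"
      using ya aS bS by (intro equiv_append_right) auto
    moreover have "x @ a @ rev a @ b \<simeq> x @ b"
      using equiv_append_left[OF equiv_cancel_left(1)[OF aS bS] x] .
    ultimately have "y @ rev a @ b \<simeq> x @ b" by (auto intro: cox_eq.trans)
    then show ?thesis using cls_eq cox_eq.sym by metis
  qed
  show ?thesis
  proof (intro equalityI image_subsetI)
    fix b assume b: "b \<in> lists T"
    show "cls (x @ b) \<in> (\<lambda>a. cls (y @ a)) ` lists T"
      using inv[OF b] by (rule image_eqI) (use a(1) b in simp)
    show "cls (y @ b) \<in> (\<lambda>a. cls (x @ a)) ` lists T"
      using fwd[OF b] by (rule image_eqI) (use a(1) b in simp)
  qed
qed

lemma coset_singleton: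
  assumes "s \<in> S" "x \<in> lists S"
  shows "(\<lambda>a. cls (x @ a)) ` lists {s} = {cls x, cls (x @ [s])}"
proof -
  have "a \<in> lists {s} \<Longrightarrow> a \<simeq> [] \<or> a \<simeq> [s]" for a
  proof (induction a)
    case Nil
    then show ?case by (simp add: cox_eq.refl)
  next
    case (Cons b a)
    then have "[s] @ a \<simeq> [s] @ [] \<or> [s] @ a \<simeq> [s] @ [s]"
      using equiv_append_left[of a _ "[s]"] assms by auto
    then show ?case using Cons.prems equiv_square[OF assms(1)] by (auto intro: cox_eq.trans)
  qed
  then have "cls (x @ a) = cls x \<or> cls (x @ a) = cls (x @ [s])" if "a \<in> lists {s}" for a
    using cls_eq equiv_append_left[OF _ assms(2), of a] that by fastforce
  then have "(\<lambda>a. cls (x @ a)) ` lists {s} \<subseteq> {cls x, cls (x @ [s])}" by blast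
  moreover have "(\<lambda>a. cls (x @ a)) ` {[], [s]} \<subseteq> (\<lambda>a. cls (x @ a)) ` lists {s}"
    by (intro image_mono) simp
  ultimately show ?thesis by (intro equalityI) simp_all
qed

text \<open>By \<open>coset_minimal_unique\<close> the class of minimal length in a coset is unique,
  so the choice inside \<open>shortest\<close> has a determined value.\<close>

lemma shortest_cls:
  assumes "T \<subseteq> S" "coset_minimal T u" "C = (\<lambda>a. cls (u @ a)) ` lists T"
  shows "shortest S M C = cls u"
  unfolding shortest_def
proof (rule some_equality)
  have "cls u = cls (u @ [])" by simp
  then have "cls u \<in> C" using assms(3) by blast
  then show "cls u \<in> C \<and> (\<forall>v\<in>C. len u \<le> cox_length S M v)"
    using assms(2,3) by (auto simp: coset_minimal_def)
  fix X assume X: "X \<in> C \<and> (\<forall>v\<in>C. cox_length S M X \<le> cox_length S M v)"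
  then obtain b where b: "b \<in> lists T" "X = cls (u @ b)" using assms(3) by auto
  then have "b \<simeq> []" using coset_minimal_unique[OF assms(1,2)] X \<open>cls u \<in> C\<close> by auto
  then have "u @ b \<simeq> u @ []" using assms(2) by (intro equiv_append_left) (auto simp: coset_minimal_def)
  then show "X = cls u" using cls_eq b by simp
qed

text \<open>Whichever shortest word the choice returns, its letters lie in \<open>S\<close>, so the
  value is a product of numbers in (0, 1].\<close>

lemma mparam_q_bounds:
  assumes "\<forall>s\<in>S. 0 < q s \<and> q s \<le> 1" "X \<in> cox_group S M"
  shows "0 < mparam_q S M q X" "mparam_q S M q X \<le> 1"
proof -
  obtain x where x: "x \<in> lists S" "X = cls x" using assms by (auto simp: cox_group_def)
  obtain v where v: "v \<simeq> x" "length v = len x" using reduced_word_exists x by blast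
  then have "v \<in> X \<and> length v = cox_length S M X" using x equiv_in_lists by (auto simp: cox_class_def)
  then have "(SOME w. w \<in> X \<and> length w = cox_length S M X) \<in> X" by (rule someI2) simp
  then have w: "set (SOME w. w \<in> X \<and> length w = cox_length S M X) \<subseteq> S"
    using x by (auto simp: cox_class_def)
  have "set w \<subseteq> S \<Longrightarrow> 0 < prod_list (map q w) \<and> prod_list (map q w) \<le> 1" for w
    using assms(1) by (induction w) (auto intro: mult_le_one less_imp_le)
  from this[OF w] show "0 < mparam_q S M q X" "mparam_q S M q X \<le> 1"
    by (auto simp: mparam_q_def)
qed

lemma davis_cell_coset_minimal:
  assumes "(T, C) \<in> davis_cells S M k"
  obtains u where "T \<subseteq> S" "card T = k" "spherical S M T" "coset_minimal T u"
    "C = (\<lambda>a. cls (u @ a)) ` lists T" "shortest S M C = cls u"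
proof -
  obtain x where x: "x \<in> lists S" "C = cox_coset S M T (cls x)" and T: "spherical S M T" "card T = k"
    using assms by (auto simp: davis_cells_def cox_group_def)
  have TS: "T \<subseteq> S" using T by (simp add: spherical_def)
  obtain u a where ua: "coset_minimal T u" "a \<in> lists T" "reduced a" "x \<simeq> u @ a"
    using coset_minimal_decomposition[OF TS x(1)] .
  have "cls x \<in> (\<lambda>a. cls (u @ a)) ` lists T" using cls_eq[OF ua(4)] ua(2) by (rule image_eqI)
  moreover have "u \<in> lists S" using ua(1) by (simp add: coset_minimal_def)
  ultimately have "C = (\<lambda>a. cls (u @ a)) ` lists T"
    using coset_member_eq[OF TS _ x(1), of u] by (simp add: x(2) cox_coset_cls[OF TS x(1)])
  then show ?thesis using that TS T ua shortest_cls by blast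
qed

lemma cell_measure_bounds:
  assumes "\<forall>s\<in>S. 0 < q s \<and> q s \<le> 1" "c \<in> davis_cells S M k"
  shows "0 < cell_measure S M q c" "cell_measure S M q c \<le> 1"
proof -
  obtain T C where c: "c = (T, C)" by (cases c)
  obtain u where "coset_minimal T u" "shortest S M C = cls u"
    using davis_cell_coset_minimal assms(2) c by metis
  then have "shortest S M (snd c) \<in> cox_group S M"
    using c by (simp add: cls_in_cox_group coset_minimal_def)
  then show "0 < cell_measure S M q c" "cell_measure S M q c \<le> 1"
    unfolding cell_measure_def using mparam_q_bounds[OF assms(1)] by auto
qed

lemma davis_edgeE:
  assumes "e \<in> davis_cells S M 1"
  obtains s x where "s \<in> S" "x \<in> lists S" "len (x @ [s]) = Suc (len x)"
    "e = ({s}, {cls x, cls (x @ [s])})" "shortest S M (snd e) = cls x"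
proof -
  obtain T C where e: "e = (T, C)" by (cases e)
  obtain u where u: "T \<subseteq> S" "card T = 1" "coset_minimal T u"
    "C = (\<lambda>a. cls (u @ a)) ` lists T" "shortest S M C = cls u"
    using davis_cell_coset_minimal assms e by metis
  obtain s where s: "T = {s}" using u(2) by (auto simp: card_1_singleton_iff)
  have uS: "u \<in> lists S" "s \<in> S" using u s by (auto simp: coset_minimal_def)
  have "len u \<le> len (u @ [s])" using u(3) s by (auto simp: coset_minimal_def)
  then have "len (u @ [s]) = Suc (len u)" using len_snoc_cases[OF uS] by auto
  then show ?thesis using that uS u s e coset_singleton[OF uS(2,1)] by auto
qed

lemma davis_edgeI:
  assumes "s \<in> S" "x \<in> lists S"
  shows "({s}, {cls x, cls (x @ [s])}) \<in> davis_cells S M 1"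
proof -
  have "special_subgroup S M {s} = {cls [], cls [s]}"
    using coset_singleton[of s "[]"] assms by (simp add: special_subgroup_def)
  then have "spherical S M {s}" using assms by (simp add: spherical_def)
  moreover have "cox_coset S M {s} (cls x) = {cls x, cls (x @ [s])}"
    using coset_singleton assms by (simp add: cox_coset_cls)
  ultimately show ?thesis
    using cls_in_cox_group[OF assms(2)] unfolding davis_cells_def mem_Collect_eq
    by (intro exI[of _ "{s}"] exI[of _ "cls x"]) simp
qed

end

section \<open>Polygons and incidences over a triangle-free nerve with one label\<close>

locale uniform_coxeter_system = coxeter_system S M
  for S :: "'s set" and M :: "'s \<Rightarrow> 's \<Rightarrow> enat" +
  fixes m :: nat
  assumes finite_S: "finite S"
    and no_triangles: "\<And>s t u. nerve_edge S M s t \<Longrightarrow> nerve_edge S M t u \<Longrightarrow> \<not> nerve_edge S M s u"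
    and nerve_labels: "\<And>s t. nerve_edge S M s t \<Longrightarrow> M s t = enat m"
    and degree_le: "\<And>s. s \<in> S \<Longrightarrow> nerve_degree S M s \<le> m"
    and m_ge_2: "m \<ge> 2"
begin

text \<open>Nerve edges are defined by finiteness of a subgroup, while the action modulo m speaks of
  matrix entries; this connects the two.\<close>

lemma finite_label_eq: "s \<in> S \<Longrightarrow> t \<in> S \<Longrightarrow> s \<noteq> t \<Longrightarrow> M s t = enat k \<Longrightarrow> k = m"
proof -
  assume st: "s \<in> S" "t \<in> S" "s \<noteq> t" "M s t = enat k"
  then have "enat k \<ge> 2" using coxeter_matrix by (metis coxeter_matrix_def)
  then have "k > 0" by (cases k) (auto simp: zero_enat_def[symmetric])
  then have "nerve_edge S M s t"
    using finite_label_finite_dihedral st by (simp add: nerve_edge_def spherical_def)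
  then show ?thesis using nerve_labels st by fastforce
qed

lemma davis_polygonE:
  assumes "\<tau> \<in> davis_cells S M 2"
  obtains s t u where "fst \<tau> = {s, t}" "s \<noteq> t" "nerve_edge S M s t" "coset_minimal {s, t} u"
    "snd \<tau> = (\<lambda>a. cls (u @ a)) ` lists {s, t}" "shortest S M (snd \<tau>) = cls u"
    "\<forall>i. poly_vertex S M \<tau> i = cls (u @ alt_word s t i)" "poly_size S M \<tau> = 2 * m"
proof -
  obtain T C where e: "\<tau> = (T, C)" by (cases \<tau>)
  obtain u where u: "T \<subseteq> S" "card T = 2" "spherical S M T" "coset_minimal T u"
    "C = (\<lambda>a. cls (u @ a)) ` lists T" "shortest S M C = cls u"
    using davis_cell_coset_minimal assms e by metis
  \<comment> \<open>These repeat the choices made inside \<open>poly_vertex\<close> and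
    \<open>poly_size\<close>, so that the vertices become alternating words starting with
    \<open>s\<close>.\<close>
  define s where "s = (SOME s. s \<in> T)"
  define t where "t = (SOME t. t \<in> T \<and> t \<noteq> s)"
  obtain a b where ab: "T = {a, b}" "a \<noteq> b" using u(2) by (auto simp: card_2_iff)
  have s: "s \<in> T" unfolding s_def by (rule someI[of _ a]) (simp add: ab)
  have "\<exists>t. t \<in> T \<and> t \<noteq> s" using ab by auto
  then have "t \<in> T \<and> t \<noteq> s" unfolding t_def by (rule someI_ex)
  then have t: "t \<in> T" "t \<noteq> s" by auto
  have T: "T = {s, t}" using ab s t by auto
  have st: "s \<in> S" "t \<in> S" using s t u by auto
  have ne: "nerve_edge S M s t" using st t u(3) T by (simp add: nerve_edge_def)
  have uS: "u \<in> lists S" using u by (simp add: coset_minimal_def)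
  have "poly_vertex S M \<tau> i = cls (u @ alt_word s t i)" for i
    using cox_mult_cls[OF uS alt_word_in_lists[OF st]]
    by (simp add: poly_vertex_def e u(6) take_concat_replicate_pair flip: s_def t_def)
  moreover have "poly_size S M \<tau> = 2 * m"
    using nerve_labels[OF ne] by (simp add: poly_size_def e flip: s_def t_def)
  ultimately show ?thesis
    using that[of s t u] T t ne u e by simp
qed

lemma incident_subset:
  assumes \<tau>: "\<tau> \<in> davis_cells S M 2" and inc: "cell_inc S M \<tau> e \<noteq> 0"
  shows "fst e \<subseteq> fst \<tau>" "snd e \<subseteq> snd \<tau>"
    "\<exists>i<2*m. snd e = {poly_vertex S M \<tau> i, poly_vertex S M \<tau> (Suc i)}"
proof -
  obtain s t u where st: "fst \<tau> = {s, t}" "s \<noteq> t" "nerve_edge S M s t" "coset_minimal {s, t} u"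
    "snd \<tau> = (\<lambda>a. cls (u @ a)) ` lists {s, t}" "shortest S M (snd \<tau>) = cls u"
    "\<forall>i. poly_vertex S M \<tau> i = cls (u @ alt_word s t i)" "poly_size S M \<tau> = 2 * m"
    using davis_polygonE[OF \<tau>] .
  show "fst e \<subseteq> fst \<tau>" using inc by (auto simp: cell_inc_def split: if_splits)
  show ex: "\<exists>i<2*m. snd e = {poly_vertex S M \<tau> i, poly_vertex S M \<tau> (Suc i)}"
    using inc by (auto simp: cell_inc_def st(8) split: if_splits)
  have "poly_vertex S M \<tau> i \<in> snd \<tau>" for i
    unfolding st(7)[rule_format] st(5) by (intro imageI alt_word_in_lists) auto
  then show "snd e \<subseteq> snd \<tau>" using ex by auto
qed

lemma polygon_eq:
  assumes \<tau>: "\<tau> \<in> davis_cells S M 2" and x: "x \<in> lists S" "cls x \<in> snd \<tau>"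
  shows "snd \<tau> = (\<lambda>a. cls (x @ a)) ` lists (fst \<tau>)"
proof -
  obtain T C where e: "\<tau> = (T, C)" by (cases \<tau>)
  obtain u where u: "T \<subseteq> S" "coset_minimal T u" "C = (\<lambda>a. cls (u @ a)) ` lists T"
    using davis_cell_coset_minimal \<tau> e by metis
  then show ?thesis using coset_member_eq[of T u x] x e by (simp add: coset_minimal_def)
qed

text \<open>The edge fixes the coset up to its second generator t, so the cells around an edge of
  type s are counted by the neighbors of s in the nerve.\<close>

lemma incident_polygon_eq:
  assumes \<tau>: "\<tau> \<in> davis_cells S M 2" and s: "s \<in> S" and x: "x \<in> lists S"
    and inc: "cell_inc S M \<tau> ({s}, {cls x, cls (x @ [s])}) \<noteq> 0"
  obtains t where "nerve_edge S M s t" "\<tau> = ({s, t}, (\<lambda>a. cls (x @ a)) ` lists {s, t})"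
proof -
  obtain a b where ab: "fst \<tau> = {a, b}" "a \<noteq> b" "nerve_edge S M a b"
    using davis_polygonE[OF \<tau>] by metis
  have "s \<in> fst \<tau>" using incident_subset(1)[OF \<tau> inc] by simp
  then obtain t where t: "fst \<tau> = {s, t}" "nerve_edge S M s t"
    using ab by (auto simp: nerve_edge_def insert_commute)
  moreover have "snd \<tau> = (\<lambda>a. cls (x @ a)) ` lists (fst \<tau>)"
    using incident_subset(2)[OF \<tau> inc] by (intro polygon_eq \<tau> x) auto
  ultimately show ?thesis using that by (metis prod.collapse)
qed

abbreviation cofaces :: "'s cell \<Rightarrow> 's cell set" where
  "cofaces e \<equiv> {\<tau> \<in> davis_cells S M 2. cell_inc S M \<tau> e \<noteq> 0}"

lemma cofaces_card:
  assumes "e \<in> davis_cells S M 1"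
  shows "finite (cofaces e)" "card (cofaces e) \<le> m"
proof -
  obtain s x where sx: "s \<in> S" "x \<in> lists S" "e = ({s}, {cls x, cls (x @ [s])})"
    using davis_edgeE[OF assms] by metis
  let ?N = "{t \<in> S. nerve_edge S M s t}"
  let ?f = "\<lambda>t. ({s, t}, (\<lambda>a. cls (x @ a)) ` lists {s, t})"
  have sub: "cofaces e \<subseteq> ?f ` ?N"
  proof
    fix \<tau> assume "\<tau> \<in> cofaces e"
    then obtain t where "nerve_edge S M s t" "\<tau> = ?f t"
      using incident_polygon_eq[of \<tau> s x] sx by auto
    then show "\<tau> \<in> ?f ` ?N" by (auto simp: nerve_edge_def)
  qed
  have fin: "finite ?N" using finite_S by simp
  show "finite (cofaces e)" using sub fin finite_subset by blast
  have "card (cofaces e) \<le> card ?N" using surj_card_le[OF fin sub] .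
  then show "card (cofaces e) \<le> m" using degree_le[OF sx(1)] by (simp add: nerve_degree_def)
qed

definition top_edges :: "'s cell \<Rightarrow> 's cell set" where
  "top_edges \<tau> = {e \<in> davis_cells S M 1. cell_inc S M \<tau> e \<noteq> 0 \<and> shortest S M (snd \<tau>) \<notin> snd e}"

lemma top_edges_card:
  assumes \<tau>: "\<tau> \<in> davis_cells S M 2"
  shows "finite (top_edges \<tau>)" "2 * (m - 1) \<le> card (top_edges \<tau>)"
proof -
  obtain s t u where st: "fst \<tau> = {s, t}" "s \<noteq> t" "nerve_edge S M s t" "coset_minimal {s, t} u"
    "snd \<tau> = (\<lambda>a. cls (u @ a)) ` lists {s, t}" "shortest S M (snd \<tau>) = cls u"
    "\<forall>i. poly_vertex S M \<tau> i = cls (u @ alt_word s t i)" "poly_size S M \<tau> = 2 * m"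
    using davis_polygonE[OF \<tau>] .
  have S: "s \<in> S" "t \<in> S" "u \<in> lists S" using st by (auto simp: nerve_edge_def coset_minimal_def)
  let ?v = "poly_vertex S M \<tau>"
  have inj: "?v i = ?v j \<longleftrightarrow> i = j" if "i < 2 * m" "j < 2 * m" for i j
  proof
    assume "?v i = ?v j"
    then have "alt_word s t i \<simeq> alt_word s t j"
      using S alt_word_in_lists[OF S(1,2)] by (simp add: st(7) cls_eq_iff equiv_left_cancel)
    then show "i = j" by (intro alt_word_inj[of m, OF _ st(2) that]) (use finite_label_eq in auto)
  qed simp
  show fin: "finite (top_edges \<tau>)"
  proof (rule finite_subset)
    show "top_edges \<tau> \<subseteq> Pow {s, t} \<times> (\<lambda>i. {?v i, ?v (Suc i)}) ` {..<2*m}"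
    proof
      fix e assume "e \<in> top_edges \<tau>"
      then have inc: "cell_inc S M \<tau> e \<noteq> 0" by (simp add: top_edges_def)
      have "fst e \<in> Pow {s, t}" using incident_subset(1)[OF \<tau> inc] st(1) by simp
      moreover have "snd e \<in> (\<lambda>i. {?v i, ?v (Suc i)}) ` {..<2*m}"
        using incident_subset(3)[OF \<tau> inc] by blast
      ultimately show "e \<in> Pow {s, t} \<times> (\<lambda>i. {?v i, ?v (Suc i)}) ` {..<2*m}"
        by (simp add: mem_Times_iff)
    qed
  qed simp
  let ?l = "\<lambda>i::nat. if even i then s else t"
  let ?e = "\<lambda>i. ({?l i}, {?v i, ?v (Suc i)})"
  have e1: "?e i \<in> davis_cells S M 1" for i
  proof -
    have "?v (Suc i) = cls ((u @ alt_word s t i) @ [?l i])" by (simp add: st(7) alt_word_Suc)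
    then show ?thesis
      using davis_edgeI[of "?l i" "u @ alt_word s t i"] S alt_word_in_lists[OF S(1,2)]
      by (simp add: st(7))
  qed
  \<comment> \<open>Edges 0 and 2m - 1 are the two that meet v_0 = v_{2m}. The range 1, ..., 2m - 2
    also keeps both \<open>i\<close> and \<open>Suc i\<close> below \<open>2 * m\<close>, where
    vertices are known to be distinct.\<close>
  have "?e i \<in> top_edges \<tau>" if i: "i \<in> {1..<2*m-1}" for i
  proof -
    have il: "i < 2 * m" "Suc i < 2 * m" "i \<noteq> 0" using i by auto
    \<comment> \<open>Whichever endpoint is the shorter one, one of the two nonzero branches of
      \<open>cell_inc\<close> applies.\<close>
    have "shortest S M {?v i, ?v (Suc i)} \<in> {?v i, ?v (Suc i)}"
      using davis_edgeE[OF e1[of i]] by (metis insertI1 snd_conv)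
    moreover have "i < poly_size S M \<tau>" using i st(8) by auto
    ultimately have "cell_inc S M \<tau> (?e i) \<noteq> 0"
      using st(1) by (auto simp: cell_inc_def)
    moreover have "cls u = ?v 0" by (simp add: st(7))
    then have "cls u \<noteq> ?v i" "cls u \<noteq> ?v (Suc i)" using inj[of 0 i] inj[of 0 "Suc i"] il by simp_all
    ultimately show ?thesis using e1 st(6) by (simp add: top_edges_def)
  qed
  then have sub: "?e ` {1..<2*m-1} \<subseteq> top_edges \<tau>" by (rule image_subsetI)
  have "inj_on ?e {1..<2*m-1}"
  proof (rule inj_onI)
    fix i j assume ij: "i \<in> {1..<2*m-1}" "j \<in> {1..<2*m-1}" "?e i = ?e j"
    then have "?v i = ?v j \<or> ?v i = ?v (Suc j) \<and> ?v (Suc i) = ?v j" by (auto simp: doubleton_eq_iff)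
    moreover have "i < 2 * m" "Suc i < 2 * m" "j < 2 * m" "Suc j < 2 * m" using ij by auto
    ultimately have "i = j \<or> i = Suc j \<and> Suc i = j" by (simp only: inj)
    then show "i = j" by arith
  qed
  then have "card {1..<2*m-1} \<le> card (top_edges \<tau>)"
    using sub fin by (rule card_inj_on_le)
  then show "2 * (m - 1) \<le> card (top_edges \<tau>)" by simp
qed

text \<open>Both cells contain the edge \<open>{x, xs}\<close> with \<open>x\<close> shorter than \<open>xs\<close>. If \<open>x\<close> were minimal in
  neither, it would have descents \<open>t \<noteq> t'\<close> with \<open>{s, t}\<close> and \<open>{s, t'}\<close> spherical; two descents span
  a finite dihedral group, which closes a triangle in the nerve.\<close>
lemma top_edge_bottom_of_others:
  assumes \<tau>: "\<tau> \<in> davis_cells S M 2" and \<tau>': "\<tau>' \<in> davis_cells S M 2" and ne: "\<tau> \<noteq> \<tau>'"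
    and e: "e \<in> top_edges \<tau>" and inc': "cell_inc S M \<tau>' e \<noteq> 0"
  shows "shortest S M (snd \<tau>') \<in> snd e"
    "cox_length S M (shortest S M (snd \<tau>)) < cox_length S M (shortest S M (snd \<tau>'))"
proof -
  have e1: "e \<in> davis_cells S M 1" and inc: "cell_inc S M \<tau> e \<noteq> 0"
    and notin: "shortest S M (snd \<tau>) \<notin> snd e" using e by (auto simp: top_edges_def)
  obtain s x where sx: "s \<in> S" "x \<in> lists S" "len (x @ [s]) = Suc (len x)"
    "e = ({s}, {cls x, cls (x @ [s])})" using davis_edgeE[OF e1] by metis
  obtain t where t: "nerve_edge S M s t" "\<tau> = ({s, t}, (\<lambda>a. cls (x @ a)) ` lists {s, t})"
    using incident_polygon_eq[OF \<tau> sx(1,2)] inc sx(4) by blast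
  obtain t' where t': "nerve_edge S M s t'" "\<tau>' = ({s, t'}, (\<lambda>a. cls (x @ a)) ` lists {s, t'})"
    using incident_polygon_eq[OF \<tau>' sx(1,2)] inc' sx(4) by blast
  have S: "{s, t} \<subseteq> S" "{s, t'} \<subseteq> S" using t t' by (auto simp: nerve_edge_def)
  have "\<not> coset_minimal {s, t} x"
    using shortest_cls[OF S(1) _ HOL.refl, of x] notin sx(4) t(2) by auto
  then have d: "len (x @ [t]) < len x"
    using descent_if_not_coset_minimal[OF S(1) sx(2)] sx(3) by auto
  have min: "coset_minimal {s, t'} x"
  proof (rule ccontr)
    assume "\<not> coset_minimal {s, t'} x"
    then have d': "len (x @ [t']) < len x"
      using descent_if_not_coset_minimal[OF S(2) sx(2)] sx(3) by auto
    have "t \<noteq> t'" using t t' ne by auto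
    then have "nerve_edge S M t t'"
      using two_descents_finite_dihedral[OF _ _ _ sx(2) d d'] S
      by (simp add: nerve_edge_def spherical_def)
    then show False using no_triangles t t' by blast
  qed
  have sh': "shortest S M (snd \<tau>') = cls x" using shortest_cls[OF S(2) min] t' by simp
  then show "shortest S M (snd \<tau>') \<in> snd e" using sx(4) by simp
  \<comment> \<open>For the rank: the shortest element u of \<open>\<tau>\<close> is no longer than
    xt, which is shorter than x, the shortest element of \<open>\<tau>'\<close>.\<close>
  obtain u where u: "coset_minimal {s, t} u" "snd \<tau> = (\<lambda>a. cls (u @ a)) ` lists {s, t}"
    "shortest S M (snd \<tau>) = cls u"
    using davis_polygonE[OF \<tau>] t(2) by (metis fst_conv)
  have "cls (x @ [t]) \<in> snd \<tau>" unfolding t(2) by auto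
  then obtain a where "a \<in> lists {s, t}" "cls (x @ [t]) = cls (u @ a)" using u(2) by auto
  then have "len u \<le> len (x @ [t])" using u(1) by (simp add: coset_minimal_def)
  then show "cox_length S M (shortest S M (snd \<tau>)) < cox_length S M (shortest S M (snd \<tau>'))"
    using d by (simp add: u(3) sh')
qed

text \<open>An incidence is determined by its edge, since an edge that is top in two cells would
  have to contain the shortest vertex of one of them. The edge itself is one of the two at the
  shortest vertex of \<open>\<tau>'\<close>.\<close>

lemma cells_below_card:
  assumes \<tau>': "\<tau>' \<in> davis_cells S M 2"
  defines "B \<equiv> {(\<tau>, e). \<tau> \<in> davis_cells S M 2 \<and> e \<in> top_edges \<tau> \<and> \<tau>' \<in> cofaces e \<and> \<tau>' \<noteq> \<tau>}"
  shows "finite B" "card B \<le> 2"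
proof -
  obtain s t u where st: "fst \<tau>' = {s, t}" "coset_minimal {s, t} u" "shortest S M (snd \<tau>') = cls u"
    using davis_polygonE[OF \<tau>'] by metis
  have uS: "u \<in> lists S" using st by (simp add: coset_minimal_def)
  let ?f = "\<lambda>r. ({r}, {cls u, cls (u @ [r])})"
  have img: "snd ` B \<subseteq> ?f ` {s, t}"
  proof
    fix e assume "e \<in> snd ` B"
    then obtain \<tau> where \<tau>: "\<tau> \<in> davis_cells S M 2" "e \<in> top_edges \<tau>" "cell_inc S M \<tau>' e \<noteq> 0" "\<tau> \<noteq> \<tau>'"
      by (auto simp: B_def)
    then have mem: "cls u \<in> snd e" using top_edge_bottom_of_others(1)[OF \<tau>(1) \<tau>' \<tau>(4,2,3)] st by simp
    have "e \<in> davis_cells S M 1" using \<tau>(2) by (simp add: top_edges_def)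
    then obtain r x where rx: "r \<in> S" "x \<in> lists S" "e = ({r}, {cls x, cls (x @ [r])})"
      using davis_edgeE by metis
    have r: "r \<in> {s, t}" using incident_subset(1)[OF \<tau>' \<tau>(3)] rx st by auto
    have "snd e = {cls u, cls (u @ [r])}"
      using mem coset_member_eq[of "{r}" x u] rx uS coset_singleton[of r] by simp
    then show "e \<in> ?f ` {s, t}" using rx r by auto
  qed
  have inj: "inj_on snd B"
  proof (rule inj_onI)
    fix p p' assume p: "p \<in> B" "p' \<in> B" "snd p = snd p'"
    obtain \<tau> e where pe: "p = (\<tau>, e)" by (cases p)
    obtain \<sigma> where pe': "p' = (\<sigma>, e)" using p pe by (cases p') auto
    have *: "\<tau> \<in> davis_cells S M 2" "e \<in> top_edges \<tau>" "\<sigma> \<in> davis_cells S M 2" "e \<in> top_edges \<sigma>"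
      using p pe pe' by (auto simp: B_def)
    have "\<tau> = \<sigma>"
    proof (rule ccontr)
      assume "\<tau> \<noteq> \<sigma>"
      moreover have "cell_inc S M \<sigma> e \<noteq> 0" using * by (simp add: top_edges_def)
      ultimately have "shortest S M (snd \<sigma>) \<in> snd e"
        using top_edge_bottom_of_others(1)[of \<tau> \<sigma> e] * by blast
      then show False using * by (simp add: top_edges_def)
    qed
    then show "p = p'" using pe pe' by simp
  qed
  have "finite (snd ` B)" using img finite_subset by blast
  then show "finite B" using inj finite_imageD by blast
  have "card B = card (snd ` B)" using inj by (simp add: card_image)
  also have "\<dots> \<le> card {s, t}" by (rule surj_card_le[OF _ img]) simp
  also have "\<dots> \<le> 2" by (simp add: card_insert_if)
  finally show "card B \<le> 2" .
qed

lemma square_summable_cycle_zero: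
  assumes summable: "(\<lambda>\<tau>. (h \<tau>)\<^sup>2) summable_on davis_cells S M 2"
    and cycle: "\<And>e. e \<in> davis_cells S M 1 \<Longrightarrow> (\<Sum>\<tau>\<in>cofaces e. of_int (cell_inc S M \<tau> e) * h \<tau>) = (0::real)"
    and "\<tau> \<in> davis_cells S M 2"
  shows "h \<tau> = 0"
proof (rule square_summable_descent_vanishes[where F = "davis_cells S M 2" and top = top_edges
      and cells = cofaces and rank = "\<lambda>\<tau>. cox_length S M (shortest S M (snd \<tau>))" and m = m])
  fix \<tau> e assume \<tau>: "\<tau> \<in> davis_cells S M 2" and e: "e \<in> top_edges \<tau>"
  then have e1: "e \<in> davis_cells S M 1" and inc: "cell_inc S M \<tau> e \<noteq> 0" by (auto simp: top_edges_def)
  show "finite (cofaces e) \<and> cofaces e \<subseteq> davis_cells S M 2 \<and> \<tau> \<in> cofaces e \<and> card (cofaces e) \<le> m"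
    using cofaces_card[OF e1] \<tau> inc by auto
  have unit: "\<bar>of_int (cell_inc S M \<sigma> e)\<bar> = (1::real)" if "\<sigma> \<in> cofaces e" for \<sigma>
    using that by (auto simp: cell_inc_def split: if_splits)
  have "of_int (cell_inc S M \<tau> e) * h \<tau> = - (\<Sum>\<sigma>\<in>cofaces e - {\<tau>}. of_int (cell_inc S M \<sigma> e) * h \<sigma>)"
    using cycle[OF e1] sum.remove[OF cofaces_card(1)[OF e1], of \<tau> "\<lambda>\<sigma>. of_int (cell_inc S M \<sigma> e) * h \<sigma>"] \<tau> inc
    by simp
  then have "\<bar>of_int (cell_inc S M \<tau> e) * h \<tau>\<bar> \<le> (\<Sum>\<sigma>\<in>cofaces e - {\<tau>}. \<bar>of_int (cell_inc S M \<sigma> e) * h \<sigma>\<bar>)"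
    by (simp only: abs_minus_cancel sum_abs)
  also have "\<dots> = (\<Sum>\<sigma>\<in>cofaces e - {\<tau>}. \<bar>h \<sigma>\<bar>)"
    by (intro sum.cong) (simp_all only: abs_mult unit DiffD1 mult_1)
  finally show "\<bar>h \<tau>\<bar> \<le> (\<Sum>\<sigma>\<in>cofaces e - {\<tau>}. \<bar>h \<sigma>\<bar>)"
    using unit[of \<tau>] \<tau> inc by (simp add: abs_mult)
next
  fix \<tau>' \<tau> e assume "\<tau>' \<in> davis_cells S M 2"
    "(\<tau>, e) \<in> {(\<tau>, e). \<tau> \<in> davis_cells S M 2 \<and> e \<in> top_edges \<tau> \<and> \<tau>' \<in> cofaces e \<and> \<tau>' \<noteq> \<tau>}"
  then show "cox_length S M (shortest S M (snd \<tau>)) < cox_length S M (shortest S M (snd \<tau>'))"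
    using top_edge_bottom_of_others(2)[of \<tau> \<tau>' e] by auto
next
  fix \<tau> assume "\<tau> \<in> davis_cells S M 2"
  then show "finite (top_edges \<tau>) \<and> 2 * (m - 1) \<le> card (top_edges \<tau>)"
    using top_edges_card by blast
next
  fix \<tau>' assume \<tau>': "\<tau>' \<in> davis_cells S M 2"
  show "finite {(\<tau>, e). \<tau> \<in> davis_cells S M 2 \<and> e \<in> top_edges \<tau> \<and> \<tau>' \<in> cofaces e \<and> \<tau>' \<noteq> \<tau>} \<and>
    card {(\<tau>, e). \<tau> \<in> davis_cells S M 2 \<and> e \<in> top_edges \<tau> \<and> \<tau>' \<in> cofaces e \<and> \<tau>' \<noteq> \<tau>} \<le> 2"
    by (intro conjI cells_below_card \<tau>')
qed (fact m_ge_2 summable assms(3))+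

end

theorem theorem7p7:
  fixes S :: "'s set" and M :: "'s \<Rightarrow> 's \<Rightarrow> enat" and m :: nat and q :: "'s \<Rightarrow> real"
  assumes "finite S"
    and "coxeter_matrix S M"
    and nerve_graph: "\<forall>T. spherical S M T \<longrightarrow> card T \<le> 2"
    and no_triangles: "\<forall>s t u. \<not> (nerve_edge S M s t \<and> nerve_edge S M t u \<and> nerve_edge S M s u)"
    and labels: "\<forall>s t. nerve_edge S M s t \<longrightarrow> M s t = enat m"
    and lcm: "Lcm (nerve_degree S M ` S) dvd m"
    and "is_multiparameter S M q"
    and "\<forall>s\<in>S. q s \<le> 1"
  shows "L2q_H2_vanishes S M q"
  unfolding L2q_H2_vanishes_def
proof (intro allI impI ballI)
  fix g \<tau>
  assume g: "l2q_chain S M q 2 g \<and> (\<forall>e\<in>davis_cells S M 1. wbdry2 S M q g e = 0)"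
    and \<tau>: "\<tau> \<in> davis_cells S M 2"
  interpret coxeter_system S M by unfold_locales fact
  have q: "\<forall>s\<in>S. 0 < q s \<and> q s \<le> 1" using assms(7,8) by (simp add: is_multiparameter_def)
  \<comment> \<open>The given 2-cell produces an edge of the nerve, whence \<open>m \<ge> 2\<close>.
    This excludes m = 0, where divisibility would give no bound on the degrees.\<close>
  obtain T where T: "spherical S M T" "card T = 2" using \<tau> by (auto simp: davis_cells_def)
  then obtain s t where "T = {s, t}" "s \<noteq> t" by (auto simp: card_2_iff)
  then have st: "nerve_edge S M s t" using T by (simp add: nerve_edge_def spherical_def)
  then have "enat m \<ge> 2" using labels coxeter_matrix by (metis coxeter_matrix_def nerve_edge_def)
  then have m: "m \<ge> 2" by (simp add: numeral_eq_enat)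
  have "nerve_degree S M s \<le> m" if "s \<in> S" for s
  proof -
    have "nerve_degree S M s dvd m" using lcm that by (meson dvd_Lcm dvd_trans imageI)
    then show ?thesis using m by (simp add: dvd_imp_le)
  qed
  then interpret uniform_coxeter_system S M m
    using assms(1) no_triangles labels m by unfold_locales blast+
  let ?\<mu> = "cell_measure S M q"
  have "?\<mu> \<tau> * g \<tau> = 0"
  proof (rule square_summable_cycle_zero[OF _ _ \<tau>])
    show "(\<lambda>\<tau>. (?\<mu> \<tau> * g \<tau>)\<^sup>2) summable_on davis_cells S M 2"
    proof (rule summable_on_comparison_test)
      show "(\<lambda>\<tau>. (g \<tau>)\<^sup>2 * ?\<mu> \<tau>) summable_on davis_cells S M 2" using g by (simp add: l2q_chain_def)
      fix \<sigma> assume "\<sigma> \<in> davis_cells S M 2"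
      then have "0 < ?\<mu> \<sigma>" "?\<mu> \<sigma> \<le> 1" using cell_measure_bounds[OF q] by auto
      then have "(g \<sigma>)\<^sup>2 * (?\<mu> \<sigma> * ?\<mu> \<sigma>) \<le> (g \<sigma>)\<^sup>2 * ?\<mu> \<sigma>"
        by (intro mult_left_mono) (auto intro: mult_left_le)
      then show "(?\<mu> \<sigma> * g \<sigma>)\<^sup>2 \<le> (g \<sigma>)\<^sup>2 * ?\<mu> \<sigma>" by (simp add: power2_eq_square mult_ac)
    qed simp
  next
    fix e assume e: "e \<in> davis_cells S M 1"
    then have "wbdry2 S M q g e = 0" "?\<mu> e > 0" using g cell_measure_bounds(1)[OF q] by auto
    then show "(\<Sum>\<tau>\<in>cofaces e. of_int (cell_inc S M \<tau> e) * (?\<mu> \<tau> * g \<tau>)) = 0"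
      by (simp add: wbdry2_def mult.assoc)
  qed
  then show "g \<tau> = 0" using cell_measure_bounds(1)[OF q \<tau>] by simp
qed

end
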